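(* Let $\mathcal{H}=\mathbb{Q}\langle Y\rangle$, $Y=\{z_k:k\in\mathbb{Z}\}$, be the quasi-shuffle Hopf algebra (quasi-shuffle product $\ast$, deconcatenation coproduct), let $N$ be the linear span of non-singular words, let $\mathcal{N}$ be the two-sided ideal generated by $N$, and let $\mathcal{A}$ be a commutative unital $\mathbb{Q}$-algebra. Then the group $T_{\mathcal{A}}=\{\phi:(\mathcal{H},\ast)\to\mathcal{A}\text{ unital algebra morphism}:\phi|_N=0\}$ (under convolution) is pro-unipotent, and there is a vector subspace $W$ of $\mathcal{H}/\mathcal{N}$ such that $T_{\mathcal{A}}$ can be identified with the space $\mathcal{L}(W,\mathcal{A})$ of linear maps $W\to\mathcal{A}$ (each element of $T_{\mathcal{A}}$ being uniquely determined, through multiplicative extension, by a linear map $W\to\mathcal{A}$, and every such linear map arising).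
   Context: The quasi-shuffle product: $\mathbf{1}\ast v=v\ast\mathbf{1}=v$, $z_mv\ast z_nw=z_m(v\ast z_nw)+z_n(z_mv\ast w)+z_{m+n}(v\ast w)$. Coproduct: $\Delta(w)=\sum_{uv=w}u\otimes v$. Convolution: $\phi\star\psi=m_{\mathcal{A}}\circ(\phi\otimes\psi)\circ\Delta$. A word $z_{k_1}\cdots z_{k_n}$ is non-singular if $k_1\neq1$, $k_1+k_2\notin\{2,1,0,-2,-4,\ldots\}$ and $k_1+\cdots+k_j\notin\mathbb{Z}_{\le j}$ for $3\le j\le n$. $\mathcal{N}$ is a Hopf ideal, so $\mathcal{H}/\mathcal{N}$ is a commutative Hopf algebra and $T_{\mathcal{A}}$ is the group of $\mathcal{A}$-valued characters of $\mathcal{H}/\mathcal{N}$. *)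

theory Defs
  imports
    "HOL-Library.Poly_Mapping"
    "HOL-Algebra.Product_Groups"
    "Jordan_Normal_Form.Matrix"
begin

section \<open>Finitely supported rational combinations\<close>

definition pm_scale :: "rat \<Rightarrow> ('k \<Rightarrow>\<^sub>0 rat) \<Rightarrow> ('k \<Rightarrow>\<^sub>0 rat)" where
  "pm_scale c = Poly_Mapping.map ((*) c)"

lemma lookup_pm_scale [simp]:
  "Poly_Mapping.lookup (pm_scale c x) k = c * Poly_Mapping.lookup x k"
  by (simp add: pm_scale_def Poly_Mapping.map.rep_eq when_def)

interpretation pm: vector_space "pm_scale :: rat \<Rightarrow> ('k \<Rightarrow>\<^sub>0 rat) \<Rightarrow> _"
  by unfold_locales
    (auto intro!: poly_mapping_eqI simp: lookup_add algebra_simps)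

text \<open>\<open>lin_ext s f\<close> is the linear extension of \<open>f\<close> from basis elements to combinations, for a
  target with scalar multiplication \<open>s\<close>.\<close>

definition lin_ext ::
  "(rat \<Rightarrow> 'b \<Rightarrow> 'b) \<Rightarrow> ('k \<Rightarrow> 'b) \<Rightarrow> ('k \<Rightarrow>\<^sub>0 rat) \<Rightarrow> 'b::ab_group_add" where
  "lin_ext s f x = (\<Sum>k\<in>Poly_Mapping.keys x. s (Poly_Mapping.lookup x k) (f k))"

lemma lin_ext_superset:
  assumes "vector_space s" "finite K" "Poly_Mapping.keys x \<subseteq> K"
  shows "lin_ext s f x = (\<Sum>k\<in>K. s (Poly_Mapping.lookup x k) (f k))"
proof -
  interpret vector_space s by fact
  show ?thesis
    unfolding lin_ext_def
    by (rule sum.mono_neutral_left) (use assms in \<open>auto simp: in_keys_iff\<close>)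
qed

lemma lin_ext_add:
  assumes "vector_space s"
  shows "lin_ext s f (x + y) = lin_ext s f x + lin_ext s f y"
proof -
  interpret vector_space s by fact
  define K where "K = Poly_Mapping.keys x \<union> Poly_Mapping.keys y \<union> Poly_Mapping.keys (x + y)"
  have "lin_ext s f z = (\<Sum>k\<in>K. s (Poly_Mapping.lookup z k) (f k))" if "z \<in> {x, y, x + y}" for z
    by (rule lin_ext_superset) (use that assms in \<open>auto simp: K_def\<close>)
  then show ?thesis
    by (simp add: lookup_add scale_left_distrib sum.distrib)
qed

lemma lin_ext_scale:
  assumes "vector_space s"
  shows "lin_ext s f (pm_scale c x) = s c (lin_ext s f x)"
proof -
  interpret vector_space s by fact
  have "lin_ext s f (pm_scale c x)
      = (\<Sum>k\<in>Poly_Mapping.keys x. s (Poly_Mapping.lookup (pm_scale c x) k) (f k))"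
    by (rule lin_ext_superset) (use assms in \<open>auto simp: in_keys_iff\<close>)
  then show ?thesis
    by (simp add: lin_ext_def scale_sum_right)
qed

lemma lin_ext_single:
  assumes "vector_space s"
  shows "lin_ext s f (Poly_Mapping.single k c) = s c (f k)"
proof -
  interpret vector_space s by fact
  have "lin_ext s f (Poly_Mapping.single k c)
      = (\<Sum>j\<in>{k}. s (Poly_Mapping.lookup (Poly_Mapping.single k c) j) (f j))"
    by (rule lin_ext_superset) (use assms in auto)
  then show ?thesis by simp
qed

lemmas pm_ext_add = lin_ext_add[OF pm.vector_space_axioms]
  and pm_ext_scale = lin_ext_scale[OF pm.vector_space_axioms]
  and pm_ext_single = lin_ext_single[OF pm.vector_space_axioms]

section \<open>The quasi-shuffle Hopf algebra on the letters \<open>z\<^sub>k\<close>, \<open>k \<in> \<int>\<close>\<close>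

text \<open>The word \<open>z\<^bsub>k1\<^esub> \<dots> z\<^bsub>kn\<^esub>\<close> is the list \<open>[k1, \<dots>, kn]\<close>.\<close>

type_synonym qsh = "int list \<Rightarrow>\<^sub>0 rat"

definition word :: "int list \<Rightarrow> qsh" where
  "word w = Poly_Mapping.single w 1"

definition letter_cons :: "int \<Rightarrow> qsh \<Rightarrow> qsh" where
  "letter_cons k = lin_ext pm_scale (\<lambda>w. word (k # w))"

fun qs_words :: "int list \<Rightarrow> int list \<Rightarrow> qsh" where
  "qs_words [] v = word v"
| "qs_words v [] = word v"
| "qs_words (m # v) (n # w) =
     letter_cons m (qs_words v (n # w)) + letter_cons n (qs_words (m # v) w)
     + letter_cons (m + n) (qs_words v w)"

definition qs_mult :: "qsh \<Rightarrow> qsh \<Rightarrow> qsh" (infixl \<open>\<^bold>*\<close> 70) where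
  "x \<^bold>* y = lin_ext pm_scale (\<lambda>u. lin_ext pm_scale (\<lambda>v. qs_words u v) y) x"

text \<open>\<open>\<H> \<otimes> \<H>\<close> is the space with basis the pairs of words.\<close>

type_synonym qsh2 = "(int list \<times> int list) \<Rightarrow>\<^sub>0 rat"

definition tensor :: "qsh \<Rightarrow> qsh \<Rightarrow> qsh2" (infixl \<open>\<otimes>\<^sub>H\<close> 75) where
  "x \<otimes>\<^sub>H y =
     lin_ext pm_scale (\<lambda>u. lin_ext pm_scale (\<lambda>v. Poly_Mapping.single (u, v) 1) y) x"

definition comul :: "qsh \<Rightarrow> qsh2" where
  "comul = lin_ext pm_scale (\<lambda>w. \<Sum>(u, v) | u @ v = w. word u \<otimes>\<^sub>H word v)"

definition counit :: "qsh \<Rightarrow> rat" where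
  "counit x = Poly_Mapping.lookup x []"

subsection \<open>\<open>\<H>\<close> is a commutative ring\<close>

lemma qsh_induct [case_names word scale add]:
  assumes "\<And>w. P (word w)" "\<And>c x. P x \<Longrightarrow> P (pm_scale c x)" "\<And>x y. P x \<Longrightarrow> P y \<Longrightarrow> P (x + y)"
  shows "P (x :: qsh)"
proof -
  have P0: "P 0"
    using assms(2)[OF assms(1), of 0 "[]"] by simp
  have "x = (\<Sum>w\<in>Poly_Mapping.keys x. pm_scale (Poly_Mapping.lookup x w) (word w))"
    by (rule poly_mapping_eqI)
      (simp add: lookup_sum word_def lookup_single when_def in_keys_iff if_distrib cong: if_cong)
  moreover have "P (\<Sum>w\<in>A. pm_scale (Poly_Mapping.lookup x w) (word w))" if "finite A" for A
    using that by (induction A) (auto intro: P0 assms)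
  ultimately show ?thesis by (metis finite_keys)
qed

lemma letter_cons_add: "letter_cons k (x + y) = letter_cons k x + letter_cons k y"
  by (simp add: letter_cons_def pm_ext_add)

lemma letter_cons_scale: "letter_cons k (pm_scale c x) = pm_scale c (letter_cons k x)"
  by (simp add: letter_cons_def pm_ext_scale)

lemma letter_cons_word [simp]: "letter_cons k (word w) = word (k # w)"
  by (simp add: letter_cons_def word_def pm_ext_single)

lemma qs_words_Nil2 [simp]: "qs_words v [] = word v"
  by (cases v) auto

lemma qs_mult_word: "word u \<^bold>* word v = qs_words u v"
  by (simp add: qs_mult_def word_def pm_ext_single)

lemma qs_mult_add_left: "(x + y) \<^bold>* z = x \<^bold>* z + y \<^bold>* z"
  by (simp add: qs_mult_def pm_ext_add)

lemma qs_mult_scale_left: "pm_scale c x \<^bold>* y = pm_scale c (x \<^bold>* y)"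
  by (simp add: qs_mult_def pm_ext_scale)

lemma qs_mult_add_right: "x \<^bold>* (y + z) = x \<^bold>* y + x \<^bold>* z"
  by (simp add: qs_mult_def pm_ext_add)
    (simp add: lin_ext_def pm.scale_right_distrib sum.distrib)

lemma qs_mult_scale_right: "x \<^bold>* pm_scale c y = pm_scale c (x \<^bold>* y)"
  by (simp add: qs_mult_def pm_ext_scale)
    (simp add: lin_ext_def pm.scale_sum_right mult.commute mult.left_commute)

lemmas qs_bilinear =
  qs_mult_add_left qs_mult_add_right qs_mult_scale_left qs_mult_scale_right
  letter_cons_add letter_cons_scale pm.scale_right_distrib

lemma qs_words_commute: "qs_words u v = qs_words v u"
  by (induction u v rule: qs_words.induct) (auto simp: add_ac)

lemma qs_mult_commute: "x \<^bold>* y = y \<^bold>* x"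
proof (induction x rule: qsh_induct)
  case (word u)
  show ?case
    by (induction y rule: qsh_induct)
      (auto simp: qs_bilinear qs_mult_word qs_words_commute)
qed (auto simp: qs_bilinear)

lemma qs_mult_one_left: "word [] \<^bold>* x = x"
  by (induction x rule: qsh_induct) (auto simp: qs_bilinear qs_mult_word)

lemma qs_mult_one_right: "x \<^bold>* word [] = x"
  using qs_mult_one_left qs_mult_commute by metis

lemma qs_mult_letters:
  "letter_cons m x \<^bold>* letter_cons n y =
     letter_cons m (x \<^bold>* letter_cons n y) + letter_cons n (letter_cons m x \<^bold>* y)
     + letter_cons (m + n) (x \<^bold>* y)"
proof (induction x rule: qsh_induct)
  case (word u)
  show ?case
    by (induction y rule: qsh_induct) (auto simp: qs_bilinear qs_mult_word)
qed (auto simp: qs_bilinear)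

lemma qs_mult_assoc_words: "(word u \<^bold>* word v) \<^bold>* word w = word u \<^bold>* (word v \<^bold>* word w)"
proof (induction "length u + length v + length w" arbitrary: u v w rule: less_induct)
  case less
  show ?case
  proof (cases "u = [] \<or> v = [] \<or> w = []")
    case True
    then show ?thesis
      by (auto simp: qs_mult_one_left qs_mult_one_right)
  next
    case False
    then obtain k a m b n c where [simp]: "u = k # a" "v = m # b" "w = n # c"
      by (auto simp: neq_Nil_conv)
    note IH = less[of a v w] less[of a v c] less[of a b w] less[of a b c]
      less[of u b w] less[of u b c]
    note L = qs_mult_letters[of k "word a" m "word b", simplified]
      qs_mult_letters[of m "word b" n "word c", simplified]
      qs_mult_letters[where n = n and y = "word c", simplified]
      qs_mult_letters[where m = k and x = "word a", simplified]
    show ?thesis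
      using IH arg_cong[OF less[of u v c], of "letter_cons n"]
      by (simp add: L qs_bilinear add_ac)
  qed
qed

lemma qs_mult_assoc: "(x \<^bold>* y) \<^bold>* z = x \<^bold>* (y \<^bold>* z)"
proof (induction x rule: qsh_induct)
  case (word u)
  show ?case
  proof (induction y rule: qsh_induct)
    case (word v)
    show ?case
      by (induction z rule: qsh_induct) (auto simp: qs_bilinear qs_mult_assoc_words)
  qed (auto simp: qs_bilinear)
qed (auto simp: qs_bilinear)

lemma counit_add: "counit (x + y) = counit x + counit y"
  and counit_scale: "counit (pm_scale c x) = c * counit x"
  and counit_word: "counit (word w) = (if w = [] then 1 else 0)"
  by (simp_all add: counit_def lookup_add word_def lookup_single when_def)

lemma counit_letter_cons: "counit (letter_cons k x) = 0"
  by (induction x rule: qsh_induct)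
    (auto simp: qs_bilinear counit_add counit_scale counit_word)

lemma counit_mult: "counit (x \<^bold>* y) = counit x * counit y"
proof (induction x rule: qsh_induct)
  case (word u)
  show ?case
  proof (induction y rule: qsh_induct)
    case (word v)
    show ?case
      by (cases u; cases v)
        (auto simp: qs_mult_word counit_add counit_word counit_letter_cons)
  qed (auto simp: qs_bilinear counit_add counit_scale algebra_simps)
qed (auto simp: qs_bilinear counit_add counit_scale algebra_simps)

section \<open>Non-singular words and the quotient \<open>\<H>/\<N>\<close>\<close>

text \<open>The empty word does not count as non-singular: it is the unit of \<open>\<H>\<close>, and no unital
  morphism kills it.\<close>

definition nonsingular :: "int list \<Rightarrow> bool" where
  "nonsingular k \<longleftrightarrow> k \<noteq> [] \<and> k ! 0 \<noteq> 1
     \<and> (2 \<le> length k \<longrightarrow> k ! 0 + k ! 1 \<notin> insert 1 {s. even s \<and> s \<le> 2})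
     \<and> (\<forall>j. 3 \<le> j \<and> j \<le> length k \<longrightarrow> (\<Sum>i<j. k ! i) \<notin> {..int j})"

definition nonsing_span :: "qsh set" where
  "nonsing_span = pm.span (word ` Collect nonsingular)"

definition qs_ideal :: "qsh set \<Rightarrow> bool" where
  "qs_ideal I \<longleftrightarrow> 0 \<in> I \<and> (\<forall>x\<in>I. \<forall>y\<in>I. x + y \<in> I) \<and> (\<forall>x\<in>I. \<forall>y. y \<^bold>* x \<in> I \<and> x \<^bold>* y \<in> I)"

definition nonsing_ideal :: "qsh set" where
  "nonsing_ideal = \<Inter> {I. qs_ideal I \<and> nonsing_span \<subseteq> I}"

lemma qs_ideal_nonsing_ideal: "qs_ideal nonsing_ideal"
  by (auto simp: nonsing_ideal_def qs_ideal_def)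

lemma nonsing_ideal_zero: "0 \<in> nonsing_ideal"
  and nonsing_ideal_add: "x \<in> nonsing_ideal \<Longrightarrow> y \<in> nonsing_ideal \<Longrightarrow> x + y \<in> nonsing_ideal"
  and nonsing_ideal_mult_left: "x \<in> nonsing_ideal \<Longrightarrow> y \<^bold>* x \<in> nonsing_ideal"
  and nonsing_ideal_mult_right: "x \<in> nonsing_ideal \<Longrightarrow> x \<^bold>* y \<in> nonsing_ideal"
  using qs_ideal_nonsing_ideal by (auto simp: qs_ideal_def)

lemma nonsing_ideal_scale: "x \<in> nonsing_ideal \<Longrightarrow> pm_scale c x \<in> nonsing_ideal"
  using nonsing_ideal_mult_left[of x "pm_scale c (word [])"]
  by (simp add: qs_bilinear qs_mult_one_left)

lemma nonsing_ideal_uminus: "x \<in> nonsing_ideal \<Longrightarrow> - x \<in> nonsing_ideal"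
  using nonsing_ideal_scale[of x "-1"] by simp

lemma nonsing_ideal_proper: "word [] \<notin> nonsing_ideal"
proof -
  have "pm.subspace {x :: qsh. counit x = 0}"
    by (rule pm.subspaceI) (auto simp: counit_add counit_scale, simp add: counit_def)
  then have "nonsing_span \<subseteq> {x. counit x = 0}"
    unfolding nonsing_span_def
    by (intro pm.span_minimal) (auto simp: counit_word nonsingular_def)
  moreover have "qs_ideal {x. counit x = 0}"
    by (auto simp: qs_ideal_def counit_add counit_mult) (simp add: counit_def)
  ultimately have "nonsing_ideal \<subseteq> {x. counit x = 0}"
    by (auto simp: nonsing_ideal_def)
  then show ?thesis by (auto simp: counit_word)
qed

quotient_type qsh_quot = qsh / "\<lambda>x y. x - y \<in> nonsing_ideal"
  morphisms quot_rep quot_class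
proof (rule equivpI)
  show "reflp (\<lambda>x y. x - y \<in> nonsing_ideal)"
    by (auto intro!: reflpI simp: nonsing_ideal_zero)
  show "symp (\<lambda>x y. x - y \<in> nonsing_ideal)"
    by (rule sympI) (use nonsing_ideal_uminus in force)
  show "transp (\<lambda>x y. x - y \<in> nonsing_ideal)"
    by (rule transpI) (use nonsing_ideal_add in force)
qed

instantiation qsh_quot :: comm_ring_1
begin

lift_definition zero_qsh_quot :: qsh_quot is 0 .

lift_definition one_qsh_quot :: qsh_quot is "word []" .

lift_definition plus_qsh_quot :: "qsh_quot \<Rightarrow> qsh_quot \<Rightarrow> qsh_quot" is "(+)"
  by (metis add_diff_add nonsing_ideal_add)

lift_definition uminus_qsh_quot :: "qsh_quot \<Rightarrow> qsh_quot" is uminus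
  by (metis minus_diff_commute minus_diff_minus nonsing_ideal_uminus)

lift_definition minus_qsh_quot :: "qsh_quot \<Rightarrow> qsh_quot \<Rightarrow> qsh_quot" is "(-)"
proof -
  fix x x' y y' :: qsh
  assume "x - x' \<in> nonsing_ideal" "y - y' \<in> nonsing_ideal"
  then have "(x - x') + - (y - y') \<in> nonsing_ideal"
    by (intro nonsing_ideal_add nonsing_ideal_uminus)
  then show "x - y - (x' - y') \<in> nonsing_ideal"
    by (simp add: algebra_simps)
qed

lift_definition times_qsh_quot :: "qsh_quot \<Rightarrow> qsh_quot \<Rightarrow> qsh_quot" is qs_mult
proof -
  fix x x' y y' :: qsh
  assume *: "x - x' \<in> nonsing_ideal" "y - y' \<in> nonsing_ideal"
  have "x \<^bold>* y = (x - x') \<^bold>* y + x' \<^bold>* (y - y') + x' \<^bold>* y'"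
    by (metis add.assoc diff_add_cancel qs_mult_add_left qs_mult_add_right)
  moreover have "(x - x') \<^bold>* y + x' \<^bold>* (y - y') \<in> nonsing_ideal"
    using * by (intro nonsing_ideal_add nonsing_ideal_mult_left nonsing_ideal_mult_right)
  ultimately show "x \<^bold>* y - x' \<^bold>* y' \<in> nonsing_ideal"
    by simp
qed

instance
proof
  show "(0::qsh_quot) \<noteq> 1"
    by transfer (use nonsing_ideal_proper nonsing_ideal_uminus in force)
next
  fix a b c :: qsh_quot
  show "a + b + c = a + (b + c)"
    by transfer (simp add: add.assoc nonsing_ideal_zero)
  show "a + b = b + a"
    by transfer (simp add: add.commute nonsing_ideal_zero)
  show "0 + a = a"
    by transfer (simp add: nonsing_ideal_zero)
  show "- a + a = 0"
    by transfer (simp add: nonsing_ideal_zero)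
  show "a - b = a + - b"
    by transfer (simp add: nonsing_ideal_zero)
  show "a * b * c = a * (b * c)"
    by transfer (simp add: qs_mult_assoc nonsing_ideal_zero)
  show "a * b = b * a"
    by transfer (metis qs_mult_commute nonsing_ideal_zero diff_self)
  show "1 * a = a"
    by transfer (simp add: qs_mult_one_left nonsing_ideal_zero)
  show "(a + b) * c = a * c + b * c"
    by transfer (simp add: qs_mult_add_left nonsing_ideal_zero)
qed

end

lift_definition quot_scale :: "rat \<Rightarrow> qsh_quot \<Rightarrow> qsh_quot" is pm_scale
  by (metis nonsing_ideal_scale pm.scale_right_diff_distrib)

interpretation quot: vector_space quot_scale
  by unfold_locales
    (transfer; simp add: nonsing_ideal_zero pm.scale_right_distrib pm.scale_left_distrib)+

inductive_set gen_subalgebra :: "qsh_quot set \<Rightarrow> qsh_quot set" for S where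
  one: "1 \<in> gen_subalgebra S"
| gen: "x \<in> S \<Longrightarrow> x \<in> gen_subalgebra S"
| add: "x \<in> gen_subalgebra S \<Longrightarrow> y \<in> gen_subalgebra S \<Longrightarrow> x + y \<in> gen_subalgebra S"
| mult: "x \<in> gen_subalgebra S \<Longrightarrow> y \<in> gen_subalgebra S \<Longrightarrow> x * y \<in> gen_subalgebra S"
| scale: "x \<in> gen_subalgebra S \<Longrightarrow> quot_scale c x \<in> gen_subalgebra S"

section \<open>The group \<open>T\<^sub>A\<close>\<close>

text \<open>Commutative unital \<open>\<rat>\<close>-algebras.  The sort is \<^class>\<open>comm_ring_1\<close> without \<open>0 \<noteq> 1\<close>, so the
  zero algebra is included.\<close>

locale rat_algebra = vector_space scale
  for scale :: "rat \<Rightarrow> 'a::{comm_ring, comm_monoid_mult} \<Rightarrow> 'a" +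
  assumes scale_mult_left: "scale c x * y = scale c (x * y)"

context
  fixes scale :: "rat \<Rightarrow> 'a::{comm_ring, comm_monoid_mult} \<Rightarrow> 'a"
begin

definition qs_characters :: "(qsh \<Rightarrow> 'a) set" where
  "qs_characters = {\<phi>. Vector_Spaces.linear pm_scale scale \<phi> \<and> \<phi> (word []) = 1
     \<and> (\<forall>x y. \<phi> (x \<^bold>* y) = \<phi> x * \<phi> y) \<and> (\<forall>x\<in>nonsing_span. \<phi> x = 0)}"

text \<open>\<open>m\<^sub>A \<circ> (\<phi> \<otimes> \<psi>) \<circ> \<Delta>\<close>\<close>

definition convolution :: "(qsh \<Rightarrow> 'a) \<Rightarrow> (qsh \<Rightarrow> 'a) \<Rightarrow> qsh \<Rightarrow> 'a" where
  "convolution \<phi> \<psi> x = lin_ext scale (\<lambda>(u, v). \<phi> (word u) * \<psi> (word v)) (comul x)"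

definition T_group :: "(qsh \<Rightarrow> 'a) monoid" where
  "T_group = \<lparr>carrier = qs_characters, monoid.mult = convolution,
     one = (\<lambda>x. scale (counit x) 1)\<rparr>"

text \<open>Elements of \<open>T\<^sub>A\<close> vanish on \<open>\<N>\<close>, so for them the choice of representative is immaterial.\<close>

definition induced :: "(qsh \<Rightarrow> 'a) \<Rightarrow> qsh_quot \<Rightarrow> 'a" where
  "induced \<phi> c = \<phi> (quot_rep c)"

definition linear_maps_on :: "qsh_quot set \<Rightarrow> (qsh_quot \<Rightarrow> 'a) set" where
  "linear_maps_on W = {f \<in> extensional W.
     (\<forall>x\<in>W. \<forall>y\<in>W. f (x + y) = f x + f y) \<and> (\<forall>c. \<forall>x\<in>W. f (quot_scale c x) = scale c (f x))}"

definition algebra_maps_on :: "qsh_quot set \<Rightarrow> (qsh_quot \<Rightarrow> 'a) set" where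
  "algebra_maps_on B = {\<chi> \<in> linear_maps_on B. \<chi> 1 = 1 \<and> (\<forall>x\<in>B. \<forall>y\<in>B. \<chi> (x * y) = \<chi> x * \<chi> y)}"

end

section \<open>Pro-unipotence\<close>

text \<open>\<open>T\<^sub>A\<close> is the group of \<open>A\<close>-points of the affine group scheme \<open>T = Spec (\<H>/\<N>)\<close> over \<open>\<rat>\<close>.
  Such a group is pro-unipotent if it is a (directed) projective limit of unipotent algebraic
  groups, that is, of closed subgroups of groups \<open>U\<^sub>n\<close> of upper unitriangular matrices.  A morphism
  from \<open>T\<close> to \<open>U\<^sub>n\<close> is a unitriangular matrix \<open>X\<close> over \<open>\<H>/\<N>\<close> with
  \<open>\<Delta>(X\<^sub>i\<^sub>j) = \<Sum>\<^sub>k X\<^sub>i\<^sub>k \<otimes> X\<^sub>k\<^sub>j\<close>; the subalgebra generated by its entries is then a Hopf subalgebra,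
  and the coordinate ring of the closed subgroup of \<open>U\<^sub>n\<close> that is the image of \<open>T\<close>.  We let \<open>X\<close> have
  entries in \<open>\<H>\<close>, and compare coproducts in
  \<open>(\<H>/\<N>) \<otimes> (\<H>/\<N>) = (\<H> \<otimes> \<H>) / (\<N> \<otimes> \<H> + \<H> \<otimes> \<N>)\<close>.\<close>

definition tensor_kernel :: "qsh2 set" where
  "tensor_kernel = pm.span {x \<otimes>\<^sub>H y | x y. x \<in> nonsing_ideal \<or> y \<in> nonsing_ideal}"

definition unitri_group :: "nat \<Rightarrow> 'a::{comm_ring, comm_monoid_mult} mat monoid" where
  "unitri_group n = \<lparr>carrier = {M \<in> carrier_mat n n. upper_triangular M \<and> (\<forall>i<n. M $$ (i, i) = 1)},
     monoid.mult = (*), one = 1\<^sub>m n\<rparr>"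

definition unipotent_rep :: "qsh mat \<Rightarrow> bool" where
  "unipotent_rep X \<longleftrightarrow> map_mat quot_class X \<in> carrier (unitri_group (dim_row X))
     \<and> (\<forall>i<dim_row X. \<forall>j<dim_row X.
          comul (X $$ (i, j)) - (\<Sum>k<dim_row X. X $$ (i, k) \<otimes>\<^sub>H X $$ (k, j)) \<in> tensor_kernel)"

definition coord_ring :: "qsh mat \<Rightarrow> qsh_quot set" where
  "coord_ring X = gen_subalgebra (quot_class ` elements_mat X)"

context
  fixes scale :: "rat \<Rightarrow> 'a::{comm_ring, comm_monoid_mult} \<Rightarrow> 'a"
begin

text \<open>The \<open>A\<close>-point of the image of \<open>X\<close> that corresponds to the algebra morphism \<open>\<chi>\<close> on
  \<^term>\<open>coord_ring X\<close>.\<close>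

definition point :: "qsh mat \<Rightarrow> (qsh_quot \<Rightarrow> 'a) \<Rightarrow> 'a mat" where
  "point X \<chi> = map_mat (\<lambda>x. \<chi> (quot_class x)) X"

definition image_group :: "qsh mat \<Rightarrow> 'a mat monoid" where
  "image_group X = (unitri_group (dim_row X))
     \<lparr>carrier := point X ` algebra_maps_on scale (coord_ring X)\<rparr>"

text \<open>The transition map from the image of \<open>Y\<close> to the image of \<open>X\<close> is dual to an inclusion of
  coordinate rings: it sends the point of \<open>\<chi>\<close> on \<open>Y\<close> to the point of (the restriction of) \<open>\<chi>\<close> on
  \<open>X\<close>.\<close>

definition proj_limit :: "qsh mat set \<Rightarrow> (qsh mat \<Rightarrow> 'a mat) monoid" where
  "proj_limit R = (product_group R image_group)
     \<lparr>carrier := {s \<in> \<Pi>\<^sub>E X\<in>R. carrier (image_group X).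
        \<forall>X\<in>R. \<forall>Y\<in>R. coord_ring X \<subseteq> coord_ring Y \<longrightarrow>
          (\<exists>\<chi>\<in>algebra_maps_on scale (coord_ring Y). s X = point X \<chi> \<and> s Y = point Y \<chi>)}\<rparr>"

definition T_pro_unipotent :: bool where
  "T_pro_unipotent \<longleftrightarrow> (\<exists>R. R \<noteq> {} \<and> (\<forall>X\<in>R. unipotent_rep X)
     \<and> (\<forall>X\<in>R. \<forall>Y\<in>R. \<exists>Z\<in>R. coord_ring X \<union> coord_ring Y \<subseteq> coord_ring Z)
     \<and> (\<Union>X\<in>R. coord_ring X) = UNIV
     \<and> (\<lambda>\<phi>. \<lambda>X\<in>R. map_mat \<phi> X) \<in> iso (T_group scale) (proj_limit R))"

end

end

theory Submission
  imports Defs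
begin

text \<open>A linear map on \<open>\<H>\<close> is a function on words, and convolution is the product over all ways to
  cut a word in two.  As deconcatenation lowers lengths, every function with value \<open>0\<close> on the empty
  word has a convolution exponential, and \<open>exp\<close> is a bijection onto the functions with value \<open>1\<close>
  there; since deconcatenation is multiplicative for the quasi-shuffle product, it restricts to a
  bijection from infinitesimal characters (which kill products of nonempty words) to characters.
  Non-empty prefixes of non-singular words are non-singular, so the vanishing on such words
  passes through convolution, inverses, \<open>exp\<close> and \<open>log\<close>.

  Let \<open>e\<close> be the logarithm of the projection \<open>\<H> \<rightarrow> \<H>/\<N>\<close> and \<open>W\<close> its image.  For a character \<open>\<phi>\<close> of
  \<open>\<H>/\<N>\<close>, naturality gives \<open>\<phi> \<circ> e = log \<phi>\<close>, so \<open>\<phi>\<close> is determined by its restriction to \<open>W\<close>; conversely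
  a linear \<open>f\<close> on \<open>W\<close> is the restriction of \<open>exp (f \<circ> e)\<close>.

  For the pro-unipotence, the factors of a word \<open>w\<close> form a unitriangular matrix of coefficients, and
  the coordinate rings for \<open>u\<close> and \<open>v\<close> are both contained in the one for the concatenation of \<open>u\<close>
  and \<open>v\<close>.\<close>

section \<open>Convolution of functions on words\<close>

definition word_conv ::
  "('k list \<Rightarrow> 'a) \<Rightarrow> ('k list \<Rightarrow> 'a) \<Rightarrow> 'k list \<Rightarrow> 'a::semiring_0" (infixl \<open>\<star>\<close> 70) where
  "(f \<star> g) w = (\<Sum>i\<le>length w. f (take i w) * g (drop i w))"

definition word_unit :: "'k list \<Rightarrow> 'a::{zero, one}" where
  "word_unit w = (if w = [] then 1 else 0)"

lemma word_unit_simps [simp]: "word_unit [] = 1" "word_unit (k # w) = 0"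
  by (simp_all add: word_unit_def)

lemma word_conv_Nil [simp]: "(f \<star> g) [] = f [] * g []"
  by (simp add: word_conv_def)

text \<open>The cut before the first letter is split off; the other cuts are cuts of
  \<open>w\<close>, with the letter \<open>k\<close> absorbed into \<open>f\<close>. This is why
  later inductions keep \<open>f\<close> arbitrary.\<close>

lemma word_conv_Cons: "(f \<star> g) (k # w) = f [] * g (k # w) + ((\<lambda>u. f (k # u)) \<star> g) w"
  by (simp add: word_conv_def sum.atMost_Suc_shift del: sum.atMost_Suc)

lemma word_conv_assoc: "((f \<star> g) \<star> h) w = (f \<star> (g \<star> h)) w"
proof (induction w arbitrary: f)
  case (Cons k w)
  have "((\<lambda>u. (f \<star> g) (k # u)) \<star> h) w
      = f [] * ((\<lambda>u. g (k # u)) \<star> h) w + (((\<lambda>u. f (k # u)) \<star> g) \<star> h) w"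
    by (simp add: word_conv_Cons word_conv_def[where g = h] distrib_right sum.distrib
        sum_distrib_left mult.assoc)
  then show ?case
    by (simp add: word_conv_Cons Cons distrib_left mult.assoc add.assoc)
qed (simp add: mult.assoc)

lemma word_conv_unit_left: "(word_unit \<star> f) w = (f w :: 'a::{semiring_0, monoid_mult})"
  by (cases w) (auto simp: word_conv_Cons word_conv_def[where f = "\<lambda>_. 0"])

lemma word_conv_unit_right: "(f \<star> word_unit) w = (f w :: 'a::{semiring_0, monoid_mult})"
  by (induction w arbitrary: f) (auto simp: word_conv_Cons)

lemma word_conv_cong:
  assumes "\<And>i. i \<le> length w \<Longrightarrow> f (take i w) * g (drop i w) = f' (take i w) * g' (drop i w)"
  shows "(f \<star> g) w = (f' \<star> g') w"
  using assms by (simp add: word_conv_def)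

lemma sum_splittings: "(\<Sum>(u, v) | u @ v = w. F u v) = (\<Sum>i\<le>length w. F (take i w) (drop i w))"
  by (rule sum.reindex_bij_witness[where i = "\<lambda>i. (take i w, drop i w)" and j = "\<lambda>(u, v). length u"])
    auto

section \<open>Prefixes of nonsingular words and lengths of words in a product\<close>

lemma nonsingular_take:
  assumes "nonsingular w" "0 < i"
  shows "nonsingular (take i w)"
  \<comment> \<open>All conditions concern partial sums counted from the left, so truncation only
    discards some of them; \<open>0 < i\<close> keeps the first letter.\<close>
  using assms by (auto simp: nonsingular_def)

lemma word_in_nonsing_span: "nonsingular w \<Longrightarrow> word w \<in> nonsing_span"
  by (auto simp: nonsing_span_def intro: pm.span_base)

lemma keys_letter_cons:
  "w \<in> Poly_Mapping.keys (letter_cons k x) \<Longrightarrow> \<exists>u\<in>Poly_Mapping.keys x. w = k # u"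
  unfolding letter_cons_def lin_ext_def word_def
  by (drule subsetD[OF keys_sum]) (auto simp: in_keys_iff lookup_single when_def split: if_splits)

text \<open>Each step of the recursion emits one letter and consumes one or two. The bound lets
  series on all words of a product be truncated at a common degree.\<close>

lemma length_keys_qs_words:
  "w \<in> Poly_Mapping.keys (qs_words u v) \<Longrightarrow> length w \<le> length u + length v"
proof (induction u v arbitrary: w rule: qs_words.induct)
  case (3 m v n u)
  consider "w \<in> Poly_Mapping.keys (letter_cons m (qs_words v (n # u)))"
    | "w \<in> Poly_Mapping.keys (letter_cons n (qs_words (m # v) u))"
    | "w \<in> Poly_Mapping.keys (letter_cons (m + n) (qs_words v u))"
    using 3(4) keys_add[of "letter_cons m (qs_words v (n # u)) + letter_cons n (qs_words (m # v) u)"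
        "letter_cons (m + n) (qs_words v u)"]
      keys_add[of "letter_cons m (qs_words v (n # u))" "letter_cons n (qs_words (m # v) u)"]
    by auto
  then show ?case
  proof cases
    case 1
    from keys_letter_cons[OF this] show ?thesis using 3(1) by auto
  next
    case 2
    from keys_letter_cons[OF this] obtain a
      where "a \<in> Poly_Mapping.keys (qs_words (m # v) u)" "w = n # a" by blast
    with "3.IH"(2)[of a] show ?thesis by simp
  next
    case 3
    from keys_letter_cons[OF this] obtain a
      where "a \<in> Poly_Mapping.keys (qs_words v u)" "w = (m + n) # a" by blast
    with "3.IH"(3)[of a] show ?thesis by simp
  qed
qed (auto simp: word_def)

text \<open>The recursion solves \<open>word_inv f \<star> f = word_unit\<close> for the cut with
  empty suffix, whose coefficient is \<open>f [] = 1\<close>.\<close>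

fun word_inv :: "('k list \<Rightarrow> 'a) \<Rightarrow> 'k list \<Rightarrow> 'a::{comm_ring, comm_monoid_mult}" where
  "word_inv f w = (if w = [] then 1 else - (\<Sum>i<length w. word_inv f (take i w) * f (drop i w)))"

declare word_inv.simps [simp del]

lemma word_inv_Nil [simp]: "word_inv f [] = 1"
  by (simp add: word_inv.simps)

lemma word_conv_inv:
  assumes "f [] = 1"
  shows "(word_inv f \<star> f) w = word_unit w"
proof (cases "w = []")
  case False
  have "(word_inv f \<star> f) w = (\<Sum>i<length w. word_inv f (take i w) * f (drop i w)) + word_inv f w"
    using assms by (simp add: word_conv_def flip: lessThan_Suc_atMost)
  also have "\<dots> = 0"
    using False by (simp add: word_inv.simps[of f w])
  finally show ?thesis
    using False by (simp add: word_unit_def)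
qed (simp add: assms)

lemma tensor_word: "word u \<otimes>\<^sub>H word v = Poly_Mapping.single (u, v) 1"
  by (simp add: tensor_def word_def pm_ext_single)

lemma comul_word: "comul (word w) = (\<Sum>i\<le>length w. word (take i w) \<otimes>\<^sub>H word (drop i w))"
  by (simp add: comul_def sum_splittings) (simp add: word_def pm_ext_single)

lemma tensor_zero [simp]: "0 \<otimes>\<^sub>H y = 0" "x \<otimes>\<^sub>H 0 = 0"
  by (simp_all add: tensor_def lin_ext_def)

section \<open>Linear extension to the quasi-shuffle algebra\<close>

context rat_algebra
begin

lemma scale_mult_right: "x * scale c y = scale c (x * y)"
  by (metis mult.commute scale_mult_left)

abbreviation ext :: "('k \<Rightarrow> 'a) \<Rightarrow> ('k \<Rightarrow>\<^sub>0 rat) \<Rightarrow> 'a" where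
  "ext \<equiv> lin_ext scale"

lemmas ext_add = lin_ext_add[OF vector_space_axioms]
  and ext_scale = lin_ext_scale[OF vector_space_axioms]
  and ext_single = lin_ext_single[OF vector_space_axioms]

lemma ext_word [simp]: "ext f (word w) = f w"
  by (simp add: word_def ext_single)

lemma ext_zero [simp]: "ext f 0 = 0"
  by (simp add: lin_ext_def)

lemma ext_sum: "ext f (sum g I) = (\<Sum>i\<in>I. ext f (g i))"
  by (induction I rule: infinite_finite_induct) (simp_all add: ext_add)

lemma ext_add_fun: "ext (\<lambda>w. f w + g w) x = ext f x + ext g x"
  by (simp add: lin_ext_def scale_right_distrib sum.distrib)

lemma ext_mult_fun: "ext (\<lambda>w. a * f w) x = a * ext f x"
  by (simp add: lin_ext_def sum_distrib_left scale_mult_right)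

lemma ext_scale_fun: "ext (\<lambda>w. scale c (f w)) x = scale c (ext f x)"
  by (simp add: lin_ext_def scale_sum_right mult.commute)

lemma ext_sum_fun: "ext (\<lambda>w. \<Sum>i\<in>I. f i w) x = (\<Sum>i\<in>I. ext (f i) x)"
  unfolding lin_ext_def scale_sum_right by (rule sum.swap)

lemma ext_cong: "(\<And>w. w \<in> Poly_Mapping.keys x \<Longrightarrow> f w = g w) \<Longrightarrow> ext f x = ext g x"
  by (simp add: lin_ext_def)

lemma ext_letter_cons: "ext f (letter_cons k x) = ext (\<lambda>w. f (k # w)) x"
  by (induction x rule: qsh_induct)
    (simp_all add: letter_cons_add letter_cons_scale ext_add ext_scale)

lemma ext_conv_letter_cons:
  "ext (f \<star> g) (letter_cons k x) = f [] * ext g (letter_cons k x) + ext ((\<lambda>w. f (k # w)) \<star> g) x"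
  by (simp add: ext_letter_cons word_conv_Cons ext_add_fun ext_mult_fun)

text \<open>Multiplicativity of deconcatenation for the quasi-shuffle product, dually.\<close>

lemma ext_conv_qs_words:
  "ext (f \<star> g) (qs_words u v) = (\<Sum>i\<le>length u. \<Sum>j\<le>length v.
     ext f (qs_words (take i u) (take j v)) * ext g (qs_words (drop i u) (drop j v)))"
proof (induction u v arbitrary: f rule: qs_words.induct)
  case (3 m u n v)
  have "ext (f \<star> g) (qs_words (m # u) (n # v)) = f [] * ext g (qs_words (m # u) (n # v))
      + ext ((\<lambda>w. f (m # w)) \<star> g) (qs_words u (n # v))
      + ext ((\<lambda>w. f (n # w)) \<star> g) (qs_words (m # u) v)
      + ext ((\<lambda>w. f ((m + n) # w)) \<star> g) (qs_words u v)"
    by (simp only: qs_words.simps(3) ext_add ext_conv_letter_cons distrib_left add_ac)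
  also have "\<dots> = (\<Sum>i\<le>length (m # u). \<Sum>j\<le>length (n # v).
     ext f (qs_words (take i (m # u)) (take j (n # v)))
       * ext g (qs_words (drop i (m # u)) (drop j (n # v))))"
    \<comment> \<open>The pair of empty prefixes gives the summand with \<open>f []\<close>. All
      other pairs are sorted by the first letter of the prefix product, which is \<open>m\<close>,
      \<open>n\<close> or \<open>m + n\<close>, the last only if both prefixes are nonempty.\<close>
    unfolding 3
    by (simp add: ext_add sum.atMost_Suc_shift distrib_left distrib_right
        sum.distrib ext_letter_cons del: sum.atMost_Suc)
  finally show ?case .
qed (simp_all add: word_conv_def)


lemma ext_word_unit: "ext word_unit (qs_words u v) = word_unit u * word_unit v"
  by (cases u; cases v) (simp_all add: ext_add ext_letter_cons lin_ext_def[where f = "\<lambda>_. 0"])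

section \<open>Convolution exponential and logarithm\<close>

text \<open>The \<open>n\<close>-th convolution power of \<open>g\<close> divided by
  \<open>n!\<close>; with this normalisation the binomial formula below has no coefficients.\<close>

primrec divpow :: "('k list \<Rightarrow> 'a) \<Rightarrow> nat \<Rightarrow> 'k list \<Rightarrow> 'a" where
  "divpow g 0 = word_unit"
| "divpow g (Suc n) = (\<lambda>w. scale (1 / of_nat (Suc n)) ((g \<star> divpow g n) w))"

lemma conv_divpow: "(g \<star> divpow g n) w = scale (of_nat (Suc n)) (divpow g (Suc n) w)"
  by (simp del: of_nat_Suc)

lemma divpow_one [simp]: "divpow g (Suc 0) = g"
  by (simp add: word_conv_unit_right)

declare divpow.simps(2) [simp del]

lemma divpow_Nil [simp]: "g [] = 0 \<Longrightarrow> divpow g (Suc n) [] = 0"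
  by (simp add: divpow.simps)

lemma divpow_Suc_eq_0:
  assumes "\<And>i. i \<le> length w \<Longrightarrow> g (take i w) * divpow g n (drop i w) = 0"
  shows "divpow g (Suc n) w = 0"
  using assms by (simp add: divpow.simps word_conv_def)

text \<open>When \<open>g [] = 0\<close>, a cut of \<open>w\<close> into \<open>n\<close> factors
  contributes only if every factor is nonempty, which takes at least \<open>n\<close>
  letters.\<close>

lemma divpow_eq_0:
  assumes "g [] = 0" "length w < n"
  shows "divpow g n w = 0"
  using assms(2)
proof (induction n arbitrary: w)
  case (Suc n)
  show ?case
  proof (rule divpow_Suc_eq_0)
    fix i assume "i \<le> length w"
    then show "g (take i w) * divpow g n (drop i w) = 0"
      using Suc assms(1) by (cases i) auto
  qed
qed simp

lemma divpow_cong: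
  assumes "\<And>u. length u \<le> length w \<Longrightarrow> g u = g' u"
  shows "divpow g n w = divpow g' n w"
  using assms
proof (induction n arbitrary: w)
  case (Suc n)
  have "(g \<star> divpow g n) w = (g' \<star> divpow g' n) w"
  proof (rule word_conv_cong)
    fix i assume "i \<le> length w"
    have "divpow g n (drop i w) = divpow g' n (drop i w)"
      by (rule Suc.IH) (use Suc.prems in simp)
    then show "g (take i w) * divpow g n (drop i w) = g' (take i w) * divpow g' n (drop i w)"
      by (simp add: Suc.prems)
  qed
  then show ?case
    by (simp add: divpow.simps)
qed simp

text \<open>With two or more factors, a cut having \<open>w\<close> itself as a factor leaves empty
  words for the others, where \<open>g\<close> and \<open>g'\<close> vanish; so only shorter words
  matter. This makes the exponential triangular with respect to length.\<close>

lemma divpow_cong_shorter: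
  assumes "g [] = 0" "g' [] = 0" "\<And>u. length u < length w \<Longrightarrow> g u = g' u" "2 \<le> n"
  shows "divpow g n w = divpow g' n w"
proof -
  obtain m where n: "n = Suc (Suc m)"
    using le_Suc_ex[OF \<open>2 \<le> n\<close>] by auto
  have "(g \<star> divpow g (Suc m)) w = (g' \<star> divpow g' (Suc m)) w"
  proof (rule word_conv_cong)
    fix i assume "i \<le> length w"
    then consider "i = 0" | "i = length w" | "0 < i" "i < length w" by linarith
    then show "g (take i w) * divpow g (Suc m) (drop i w)
        = g' (take i w) * divpow g' (Suc m) (drop i w)"
    proof cases
      case 3
      have "divpow g (Suc m) (drop i w) = divpow g' (Suc m) (drop i w)"
        by (rule divpow_cong) (use 3 assms(3) in auto)
      with 3 assms(3) show ?thesis by simp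
    qed (use assms(1,2) in simp_all)
  qed
  then show ?thesis
    by (simp add: n divpow.simps(2)[of _ "Suc m"])
qed

text \<open>The exponential series; for \<open>g [] = 0\<close> its terms beyond the length of
  \<open>w\<close> vanish, so nothing is cut off.\<close>

definition word_exp :: "('k list \<Rightarrow> 'a) \<Rightarrow> 'k list \<Rightarrow> 'a" where
  "word_exp g w = (\<Sum>n\<le>length w. divpow g n w)"

lemma word_exp_Nil [simp]: "word_exp g [] = 1"
  by (simp add: word_exp_def)

lemma word_exp_eq:
  assumes "g [] = 0" "length w \<le> N"
  shows "word_exp g w = (\<Sum>n\<le>N. divpow g n w)"
  unfolding word_exp_def
  by (rule sum.mono_neutral_left) (use assms in \<open>auto intro: divpow_eq_0\<close>)

lemma word_exp_nonempty:
  assumes "w \<noteq> []"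
  shows "word_exp g w = g w + (\<Sum>n = 2..length w. divpow g n w)"
proof -
  have "{..length w} = {0, 1} \<union> {2..length w}"
    using assms by (cases w) auto
  then have "word_exp g w = (\<Sum>n\<in>{0, 1} \<union> {2..length w}. divpow g n w)"
    by (simp add: word_exp_def)
  also have "\<dots> = (\<Sum>n\<in>{0, 1}. divpow g n w) + (\<Sum>n = 2..length w. divpow g n w)"
    by (rule sum.union_disjoint) auto
  finally show ?thesis
    using assms by (simp add: word_unit_def)
qed

text \<open>Induction on length: the terms of degree at least two depend only on shorter words, so
  comparing exponentials at \<open>w\<close> compares the linear terms.\<close>

lemma word_exp_inj:
  assumes "g [] = 0" "g' [] = 0" "word_exp g = word_exp g'"
  shows "g = g'"
proof
  fix w
  show "g w = g' w"
  proof (induction w rule: length_induct)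
    case (1 w)
    show ?case
    proof (cases "w = []")
      case False
      have "(\<Sum>n = 2..length w. divpow g n w) = (\<Sum>n = 2..length w. divpow g' n w)"
        by (intro sum.cong divpow_cong_shorter) (use 1 assms in auto)
      then show ?thesis
        using word_exp_nonempty[OF False, of g] word_exp_nonempty[OF False, of g'] assms(3)
        by simp
    qed (use assms in simp)
  qed
qed

text \<open>\<open>log_approx f m\<close> is the logarithm of \<open>f\<close> on words of length at most \<open>m\<close>.\<close>

primrec log_approx :: "('k list \<Rightarrow> 'a) \<Rightarrow> nat \<Rightarrow> 'k list \<Rightarrow> 'a" where
  "log_approx f 0 = (\<lambda>w. 0)"
| "log_approx f (Suc m) =
     (\<lambda>w. if w = [] then 0 else f w - (\<Sum>n = 2..length w. divpow (log_approx f m) n w))"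

definition word_log :: "('k list \<Rightarrow> 'a) \<Rightarrow> 'k list \<Rightarrow> 'a" where
  "word_log f w = log_approx f (length w) w"

lemma log_approx_Nil [simp]: "log_approx f m [] = 0"
  by (cases m) auto

lemma word_log_Nil [simp]: "word_log f [] = 0"
  by (simp add: word_log_def)

text \<open>The correction terms of degree at least two involve only shorter words, on which the
  approximations have stabilised already.\<close>

lemma log_approx_stable: "length w \<le> m \<Longrightarrow> log_approx f m w = word_log f w"
proof (induction w arbitrary: m rule: length_induct)
  case (1 w)
  show ?case
  proof (cases "w = []")
    case False
    with 1 obtain m' where m: "m = Suc m'" "length w \<le> Suc m'"
      by (cases m) auto
    obtain l where l: "length w = Suc l"
      using False by (cases w) auto
    have "(\<Sum>n = 2..length w. divpow (log_approx f m') n w)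
        = (\<Sum>n = 2..length w. divpow (log_approx f l) n w)"
      by (intro sum.cong divpow_cong_shorter) (use 1 m l in auto)
    then show ?thesis
      using False by (simp add: m word_log_def l)
  qed simp
qed

lemma word_exp_log:
  assumes "f [] = 1"
  shows "word_exp (word_log f) = f"
proof
  fix w
  show "word_exp (word_log f) w = f w"
  proof (cases "w = []")
    case False
    obtain l where l: "length w = Suc l"
      using False by (cases w) auto
    have "(\<Sum>n = 2..length w. divpow (word_log f) n w)
        = (\<Sum>n = 2..length w. divpow (log_approx f l) n w)"
      by (intro sum.cong divpow_cong_shorter) (use l in \<open>auto simp: log_approx_stable\<close>)
    then show ?thesis
      using False by (simp add: word_exp_nonempty word_log_def l)
  qed (simp add: assms)
qed

lemma divpow_qs_words:
  assumes g0: "g [] = 0"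
    and g: "\<And>u v. u \<noteq> [] \<Longrightarrow> v \<noteq> [] \<Longrightarrow> length u + length v < N \<Longrightarrow> ext g (qs_words u v) = 0"
    and "length u + length v \<le> N" "n \<noteq> 1 \<or> length u + length v < N"
  shows "ext (divpow g n) (qs_words u v) = (\<Sum>k\<le>n. divpow g k u * divpow g (n - k) v)"
  using assms(3,4)
proof (induction n arbitrary: u v)
  case 0
  then show ?case by (simp add: ext_word_unit)
next
  case (Suc n)
  let ?E = "divpow g"
  show ?case
  proof (cases n)
    case 0
    then show ?thesis
      using Suc.prems g[of u v] g0 by (cases "u = []"; cases "v = []") (auto simp: word_unit_def)
  next
    case (Suc n')
    \<comment> \<open>\<open>A\<close> and \<open>B\<close> collect the cuts whose first factor
      takes letters from \<open>u\<close> alone or from \<open>v\<close> alone. Only these survive,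
      since \<open>g\<close> kills products of two nonempty prefixes; the pair of full prefixes,
      which the hypothesis may miss, meets \<open>divpow g n [] = 0\<close>, as \<open>n\<close> is
      positive here.\<close>
    define A where "A i = g (take i u) * (\<Sum>k\<le>n. ?E k (drop i u) * ?E (n - k) v)" for i
    define B where "B j = g (take j v) * (\<Sum>k\<le>n. ?E k u * ?E (n - k) (drop j v))" for j
    have AB0: "A 0 = 0" "B 0 = 0"
      by (simp_all add: A_def B_def g0)
    have summand: "ext g (qs_words (take i u) (take j v)) * ext (?E n) (qs_words (drop i u) (drop j v))
        = (if j = 0 then A i else 0) + (if i = 0 then B j else 0)"
      if ij: "i \<le> length u" "j \<le> length v" for i j
    proof -
      consider "i = 0" "j = 0" | "i = 0" "j > 0" | "i > 0" "j = 0"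
        | "i > 0" "j > 0" "i = length u" "j = length v"
        | "i > 0" "j > 0" "i + j < length u + length v" using ij by linarith
      then show ?thesis
      proof cases
        case 1
        then show ?thesis by (simp add: AB0 g0)
      next
        case 2
        then have "length u + length (drop j v) < N"
          using Suc.prems(1) ij by simp
        with 2 show ?thesis
          using Suc.IH[of u "drop j v"] by (simp add: B_def)
      next
        case 3
        then have "length (drop i u) + length v < N"
          using Suc.prems(1) ij by simp
        with 3 show ?thesis
          using Suc.IH[of "drop i u" v] by (simp add: A_def)
      next
        case 4
        then show ?thesis by (simp add: \<open>n = Suc n'\<close> g0)
      next
        case 5
        then have "ext g (qs_words (take i u) (take j v)) = 0"
          using Suc.prems ij by (intro g) auto
        with 5 show ?thesis by simp
      qed
    qed
    let ?P = "\<lambda>k. ?E k u * ?E (Suc n - k) v"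
    have "scale (of_nat (Suc n)) (ext (?E (Suc n)) (qs_words u v)) = ext (g \<star> ?E n) (qs_words u v)"
    proof -
      have "g \<star> ?E n = (\<lambda>w. scale (of_nat (Suc n)) (?E (Suc n) w))"
        by (intro HOL.ext conv_divpow)
      then show ?thesis by (simp only: ext_scale_fun)
    qed
    also have "\<dots> = (\<Sum>i\<le>length u. \<Sum>j\<le>length v.
        (if j = 0 then A i else 0) + (if i = 0 then B j else 0))"
      unfolding ext_conv_qs_words by (intro sum.cong refl summand) auto
    also have "\<dots> = (\<Sum>i\<le>length u. A i) + (\<Sum>j\<le>length v. B j)"
    proof -
      have "(\<Sum>i\<le>length u. \<Sum>j\<le>length v. if i = 0 then B j else 0) = (\<Sum>j\<le>length v. B j)"
        by (subst sum.swap) simp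
      then show ?thesis by (simp add: sum.distrib)
    qed
    \<comment> \<open>Convolving with \<open>g\<close> raises a divided power and yields the weight
      \<open>k + 1\<close> here and \<open>n - k + 1\<close> in the sum of the \<open>B j\<close>.
      After an index shift in the first sum the weights add up to \<open>Suc n\<close>, which
      cancels.\<close>
    also have "(\<Sum>i\<le>length u. A i) = (\<Sum>k\<le>n. (g \<star> ?E k) u * ?E (n - k) v)"
      unfolding A_def word_conv_def sum_distrib_left sum_distrib_right
      by (subst sum.swap) (simp add: mult.assoc)
    also have "\<dots> = (\<Sum>k\<le>n. scale (of_nat (Suc k)) (?P (Suc k)))"
      by (simp only: conv_divpow scale_mult_left diff_Suc_Suc)
    also have "\<dots> = (\<Sum>k\<le>Suc n. scale (of_nat k) (?P k))"
      by (subst sum.atMost_Suc_shift) simp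
    also have "(\<Sum>j\<le>length v. B j) = (\<Sum>k\<le>n. ?E k u * (g \<star> ?E (n - k)) v)"
      unfolding B_def word_conv_def sum_distrib_left
      by (subst sum.swap) (simp add: mult_ac)
    also have "\<dots> = (\<Sum>k\<le>n. scale (of_nat (Suc n - k)) (?P k))"
      by (intro sum.cong refl) (simp add: conv_divpow scale_mult_right Suc_diff_le del: of_nat_Suc)
    also have "\<dots> = (\<Sum>k\<le>Suc n. scale (of_nat (Suc n - k)) (?P k))"
      by simp
    also have "(\<Sum>k\<le>Suc n. scale (of_nat k) (?P k)) + (\<Sum>k\<le>Suc n. scale (of_nat (Suc n - k)) (?P k))
        = scale (of_nat (Suc n)) (\<Sum>k\<le>Suc n. ?P k)"
      unfolding scale_sum_right sum.distrib[symmetric]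
    proof (intro sum.cong refl)
      fix k assume "k \<in> {..Suc n}"
      then have "of_nat k + of_nat (Suc n - k) = (of_nat (Suc n) :: rat)"
        by (metis add_diff_inverse_nat atMost_iff not_less of_nat_add)
      then show "scale (of_nat k) (?P k) + scale (of_nat (Suc n - k)) (?P k)
          = scale (of_nat (Suc n)) (?P k)"
        by (metis scale_left_distrib)
    qed
    finally show ?thesis
      by (metis of_nat_neq_0 scale_left_imp_eq)
  qed
qed

text \<open>The product of the two truncated series is regrouped by total degree; the triangle
  \<open>i + j \<le> length u + length v\<close> contains the rectangle, and the additional terms
  vanish.\<close>

lemma word_exp_mult:
  assumes "g [] = 0"
  shows "word_exp g u * word_exp g v
    = (\<Sum>n\<le>length u + length v. \<Sum>k\<le>n. divpow g k u * divpow g (n - k) v)"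
proof -
  let ?N = "length u + length v"
  have "finite {(i, j). i + j \<le> ?N}"
    by (rule finite_subset[of _ "{..?N} \<times> {..?N}"]) auto
  then have "(\<Sum>(i, j)\<in>{..length u} \<times> {..length v}. divpow g i u * divpow g j v)
      = (\<Sum>(i, j)\<in>{(i, j). i + j \<le> ?N}. divpow g i u * divpow g j v)"
  proof (rule sum.mono_neutral_left)
    show "\<forall>p\<in>{(i, j). i + j \<le> ?N} - {..length u} \<times> {..length v}.
        (case p of (i, j) \<Rightarrow> divpow g i u * divpow g j v) = 0"
      using divpow_eq_0[where g = g, OF assms] by (auto simp: not_le) (metis mult_zero_left mult_zero_right not_le)+
  qed auto
  then show ?thesis
    by (simp add: word_exp_def sum_product sum.cartesian_product sum.triangle_reindex_eq)
qed

text \<open>Words in the product of \<open>u\<close> and \<open>v\<close> may differ in length,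
  hence in truncation; \<open>length u + length v\<close> bounds them all.\<close>

lemma ext_word_exp:
  assumes "g [] = 0"
  shows "ext (word_exp g) (qs_words u v)
    = (\<Sum>n\<le>length u + length v. ext (divpow g n) (qs_words u v))"
  unfolding ext_sum_fun[symmetric]
  by (rule ext_cong) (use assms length_keys_qs_words word_exp_eq in blast)

section \<open>Characters and infinitesimal characters\<close>

definition word_char :: "(int list \<Rightarrow> 'a) \<Rightarrow> bool" where
  "word_char f \<longleftrightarrow> f [] = 1 \<and> (\<forall>u v. ext f (qs_words u v) = f u * f v)
     \<and> (\<forall>w. nonsingular w \<longrightarrow> f w = 0)"

text \<open>These functions form the Lie algebra of the group, in the coordinates given by
  words.\<close>

definition word_inf_char :: "(int list \<Rightarrow> 'a) \<Rightarrow> bool" where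
  "word_inf_char g \<longleftrightarrow> g [] = 0 \<and> (\<forall>u v. u \<noteq> [] \<longrightarrow> v \<noteq> [] \<longrightarrow> ext g (qs_words u v) = 0)
     \<and> (\<forall>w. nonsingular w \<longrightarrow> g w = 0)"

lemma word_char_exp:
  assumes "word_inf_char g"
  shows "word_char (word_exp g)"
  unfolding word_char_def
proof (intro conjI allI impI)
  have g: "g [] = 0" "\<And>w. nonsingular w \<Longrightarrow> g w = 0"
    "\<And>u v. u \<noteq> [] \<Longrightarrow> v \<noteq> [] \<Longrightarrow> ext g (qs_words u v) = 0"
    using assms by (auto simp: word_inf_char_def)
  fix u v
  have "ext (divpow g n) (qs_words u v) = (\<Sum>k\<le>n. divpow g k u * divpow g (n - k) v)" for n
    \<comment> \<open>A bound beyond the total length makes the formula available in every degree,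
      including \<open>n = 1\<close>.\<close>
    by (rule divpow_qs_words[where N = "Suc (length u + length v)"]) (use g in auto)
  then show "ext (word_exp g) (qs_words u v) = word_exp g u * word_exp g v"
    by (simp add: ext_word_exp word_exp_mult g)
next
  have g: "g [] = 0" "\<And>w. nonsingular w \<Longrightarrow> g w = 0"
    using assms by (auto simp: word_inf_char_def)
  fix w :: "int list" assume w: "nonsingular w"
  have "divpow g n w = 0" for n
  proof (cases n)
    case 0
    with w show ?thesis by (auto simp: nonsingular_def word_unit_def)
  next
    case (Suc m)
    \<comment> \<open>Every prefix of \<open>w\<close> is empty or nonsingular.\<close>
    have "g (take i w) = 0" for i
      using g w nonsingular_take[OF w, of i] by (cases i) auto
    with Suc show ?thesis by (auto intro: divpow_Suc_eq_0)
  qed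
  then show "word_exp g w = 0"
    by (simp add: word_exp_def)
qed simp

text \<open>At a nonsingular word the higher terms of the exponential vanish: each cut has a factor
  at the empty word or, by induction, at a shorter nonsingular prefix. Hence the logarithm agrees
  with \<open>f\<close> there.\<close>

lemma word_log_nonsingular:
  assumes "\<And>w. nonsingular w \<Longrightarrow> f w = 0" "f [] = 1" "nonsingular w"
  shows "word_log f w = 0"
  using assms(3)
proof (induction w rule: length_induct)
  case (1 w)
  then have w: "w \<noteq> []" by (auto simp: nonsingular_def)
  have "divpow (word_log f) n w = 0" if n2: "2 \<le> n" for n
  proof -
    obtain m where n: "n = Suc (Suc m)"
      using le_Suc_ex[OF n2] by auto
    show ?thesis
      unfolding n
    proof (rule divpow_Suc_eq_0)
      fix i assume "i \<le> length w"
      then consider "i = 0" | "i = length w" | "0 < i" "i < length w" by linarith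
      then show "word_log f (take i w) * divpow (word_log f) (Suc m) (drop i w) = 0"
        by cases (use 1 nonsingular_take[OF 1(2), of i] in auto)
    qed
  qed
  then have "word_exp (word_log f) w = word_log f w"
    by (simp add: word_exp_nonempty[OF w])
  then show ?case
    using assms 1(2) by (simp add: word_exp_log)
qed

text \<open>Induction on total length. Summed over all degrees, both sides of the binomial formula
  agree because \<open>f\<close> is multiplicative; by induction they agree in every degree other
  than 1. So they agree in degree 1, where the right side is zero for nonempty \<open>u\<close> and
  \<open>v\<close>.\<close>

lemma word_inf_char_log:
  assumes "word_char f"
  shows "word_inf_char (word_log f)"
  unfolding word_inf_char_def
proof (intro conjI allI impI)
  let ?g = "word_log f"
  have f: "f [] = 1" "\<And>u v. ext f (qs_words u v) = f u * f v"
    using assms by (auto simp: word_char_def)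
  fix u v :: "int list" assume "u \<noteq> []" "v \<noteq> []"
  then show "ext ?g (qs_words u v) = 0"
  proof (induction "length u + length v" arbitrary: u v rule: less_induct)
    case less
    let ?N = "length u + length v"
    let ?Q = "\<lambda>n. \<Sum>k\<le>n. divpow ?g k u * divpow ?g (n - k) v"
    have *: "ext (divpow ?g n) (qs_words u v) = ?Q n" if "n \<noteq> 1" for n
      by (rule divpow_qs_words[where N = ?N]) (use less that in auto)
    have N: "1 \<in> {..?N}" "finite {..?N}" using less.prems by (cases u) auto
    have "(\<Sum>n\<le>?N. ext (divpow ?g n) (qs_words u v)) = (\<Sum>n\<le>?N. ?Q n)"
      using ext_word_exp[of ?g u v] word_exp_mult[of ?g u v] f by (simp add: word_exp_log)
    then have "ext (divpow ?g 1) (qs_words u v) = ?Q 1"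
      using * by (simp add: sum.remove[OF N(2,1)])
    then show ?case
      using less.prems by (simp add: word_unit_def)
  qed
qed (use assms in \<open>auto simp: word_char_def intro: word_log_nonsingular\<close>)


lemma word_char_unit: "word_char word_unit"
  by (auto simp: word_char_def ext_word_unit nonsingular_def word_unit_def)

lemma word_char_conv:
  assumes "word_char f" "word_char g"
  shows "word_char (f \<star> g)"
  unfolding word_char_def
proof (intro conjI allI impI)
  show "(f \<star> g) [] = 1"
    using assms by (simp add: word_char_def)
next
  fix u v
  show "ext (f \<star> g) (qs_words u v) = (f \<star> g) u * (f \<star> g) v"
    using assms by (simp add: word_char_def ext_conv_qs_words) (simp add: word_conv_def sum_product mult_ac)
next
  fix w :: "int list" assume w: "nonsingular w"
  \<comment> \<open>The cut \<open>i = 0\<close> hands all of \<open>w\<close> to \<open>g\<close>;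
    any other cut hands \<open>f\<close> a nonsingular prefix.\<close>
  have "f (take i w) * g (drop i w) = 0" for i
    using assms w nonsingular_take[OF w, of i] by (cases i) (auto simp: word_char_def)
  then show "(f \<star> g) w = 0"
    by (simp add: word_conv_def)
qed

text \<open>The identity \<open>word_inv f \<star> f = word_unit\<close> is evaluated on the
  product, and on \<open>u\<close> and \<open>v\<close> separately. Both expansions run over pairs
  of prefixes; by induction they agree at every pair but the full one, hence also there.\<close>

lemma word_char_inv:
  assumes "word_char f"
  shows "word_char (word_inv f)"
  unfolding word_char_def
proof (intro conjI allI impI)
  have f: "f [] = 1" "\<And>u v. ext f (qs_words u v) = f u * f v"
    using assms by (auto simp: word_char_def)
  have inv: "word_inv f \<star> f = word_unit"
    by (intro HOL.ext word_conv_inv f)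
  fix u v
  show "ext (word_inv f) (qs_words u v) = word_inv f u * word_inv f v"
  proof (induction "length u + length v" arbitrary: u v rule: less_induct)
    case less
    define S where "S = {..length u} \<times> {..length v}"
    define p where "p = (length u, length v)"
    define L where "L = (\<lambda>(i, j). ext (word_inv f) (qs_words (take i u) (take j v))
        * ext f (qs_words (drop i u) (drop j v)))"
    define R where "R = (\<lambda>(i, j). word_inv f (take i u) * f (drop i u)
        * (word_inv f (take j v) * f (drop j v)))"
    have S: "finite S" "p \<in> S" by (auto simp: S_def p_def)
    have "sum L S = ext (word_inv f \<star> f) (qs_words u v)"
      by (simp add: ext_conv_qs_words L_def S_def sum.cartesian_product)
    also have "\<dots> = (word_inv f \<star> f) u * (word_inv f \<star> f) v"
      by (simp add: inv ext_word_unit)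
    also have "\<dots> = sum R S"
      by (simp add: word_conv_def R_def S_def sum_product sum.cartesian_product)
    finally have "L p + sum L (S - {p}) = R p + sum R (S - {p})"
      by (simp add: sum.remove[OF S])
    moreover have "sum L (S - {p}) = sum R (S - {p})"
    proof (rule sum.cong[OF refl])
      fix q assume "q \<in> S - {p}"
      then obtain i j where q: "q = (i, j)" "i \<le> length u" "j \<le> length v"
        "i \<noteq> length u \<or> j \<noteq> length v"
        by (auto simp: S_def p_def)
      then have "ext (word_inv f) (qs_words (take i u) (take j v))
          = word_inv f (take i u) * word_inv f (take j v)"
        by (intro less) auto
      then show "L q = R q"
        by (simp add: L_def R_def q f mult_ac)
    qed
    ultimately show ?case
      by (simp add: L_def R_def p_def f)
  qed
next
  fix w :: "int list" assume "nonsingular w"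
  then show "word_inv f w = 0"
  proof (induction w rule: length_induct)
    case (1 w)
    have "word_inv f (take i w) * f (drop i w) = 0" if "i < length w" for i
      using assms 1 nonsingular_take[OF 1(2), of i] that by (cases i) (auto simp: word_char_def)
    moreover have "w \<noteq> []" using 1(2) by (auto simp: nonsingular_def)
    ultimately show ?case
      by (subst word_inv.simps) simp
  qed
qed simp

section \<open>From functions on words back to characters, and the group law\<close>

lemma qs_characters_linear:
  assumes "\<phi> \<in> qs_characters scale"
  shows "\<phi> (x + y) = \<phi> x + \<phi> y" "\<phi> (pm_scale c x) = scale c (\<phi> x)"
  using assms by (auto simp: qs_characters_def Vector_Spaces.linear_iff)

lemma qs_characters_ext:
  assumes "\<phi> \<in> qs_characters scale"
  shows "ext (\<lambda>w. \<phi> (word w)) = \<phi>"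
proof
  show "ext (\<lambda>w. \<phi> (word w)) x = \<phi> x" for x
    by (induction x rule: qsh_induct) (simp_all add: ext_add ext_scale qs_characters_linear[OF assms])
qed

lemma word_char_of_character:
  assumes "\<phi> \<in> qs_characters scale"
  shows "word_char (\<lambda>w. \<phi> (word w))"
  using assms
  by (auto simp: word_char_def qs_characters_ext word_in_nonsing_span simp flip: qs_mult_word)
    (auto simp: qs_characters_def word_in_nonsing_span)

lemma ext_mem_qs_characters:
  assumes "word_char f"
  shows "ext f \<in> qs_characters scale"
proof -
  have "ext f (x \<^bold>* y) = ext f x * ext f y" for x y
  proof (induction x rule: qsh_induct)
    case (word u)
    show ?case
      using assms by (induction y rule: qsh_induct)
        (simp_all add: qs_bilinear qs_mult_word ext_add ext_scale scale_mult_right distrib_left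
          word_char_def)
  qed (simp_all add: qs_bilinear ext_add ext_scale scale_mult_left distrib_right)
  moreover have "Vector_Spaces.linear pm_scale scale (ext f)"
    using pm.vector_space_axioms vector_space_axioms
    by (simp add: Vector_Spaces.linear_iff ext_add ext_scale)
  moreover have "nonsing_span \<subseteq> {x. ext f x = 0}"
    unfolding nonsing_span_def
  proof (rule pm.span_minimal)
    show "pm.subspace {x. ext f x = 0}"
      by (rule pm.subspaceI) (auto simp: ext_add ext_scale)
  qed (use assms in \<open>auto simp: word_char_def\<close>)
  ultimately show ?thesis
    using assms by (auto simp: qs_characters_def word_char_def)
qed

lemma convolution_eq:
  "convolution scale \<phi> \<psi> = ext ((\<lambda>u. \<phi> (word u)) \<star> (\<lambda>v. \<psi> (word v)))"
proof
  show "convolution scale \<phi> \<psi> x = ext ((\<lambda>u. \<phi> (word u)) \<star> (\<lambda>v. \<psi> (word v))) x" for x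
  proof (induction x rule: qsh_induct)
    case (word w)
    show ?case
      by (simp add: convolution_def comul_word ext_sum tensor_word ext_single word_conv_def)
  qed (simp_all add: convolution_def comul_def pm_ext_add pm_ext_scale ext_add ext_scale)
qed

lemma T_group_one: "(\<lambda>x. scale (counit x) 1) = ext word_unit"
proof
  show "scale (counit x) 1 = ext word_unit x" for x
    by (induction x rule: qsh_induct)
      (auto simp: counit_word counit_add counit_scale ext_add ext_scale scale_left_distrib word_unit_def
        simp flip: scale_scale)
qed

lemma group_T_group: "group (T_group scale)"
proof (rule groupI)
  let ?w = "\<lambda>\<phi> :: qsh \<Rightarrow> 'a. \<lambda>w. \<phi> (word w)"
  show "\<phi> \<otimes>\<^bsub>T_group scale\<^esub> \<psi> \<in> carrier (T_group scale)"
    if "\<phi> \<in> carrier (T_group scale)" "\<psi> \<in> carrier (T_group scale)" for \<phi> \<psi>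
    using that by (simp add: T_group_def convolution_eq ext_mem_qs_characters word_char_conv
        word_char_of_character)
  show "\<one>\<^bsub>T_group scale\<^esub> \<in> carrier (T_group scale)"
    by (simp add: T_group_def T_group_one ext_mem_qs_characters word_char_unit)
  show "\<phi> \<otimes>\<^bsub>T_group scale\<^esub> \<psi> \<otimes>\<^bsub>T_group scale\<^esub> \<chi>
      = \<phi> \<otimes>\<^bsub>T_group scale\<^esub> (\<psi> \<otimes>\<^bsub>T_group scale\<^esub> \<chi>)" for \<phi> \<psi> \<chi>
    by (simp add: T_group_def convolution_eq word_conv_assoc[abs_def])
  show "\<one>\<^bsub>T_group scale\<^esub> \<otimes>\<^bsub>T_group scale\<^esub> \<phi> = \<phi>"
    if "\<phi> \<in> carrier (T_group scale)" for \<phi>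
    using that by (simp add: T_group_def convolution_eq T_group_one word_conv_unit_left[abs_def]
        qs_characters_ext)
  show "\<exists>\<psi>\<in>carrier (T_group scale). \<psi> \<otimes>\<^bsub>T_group scale\<^esub> \<phi> = \<one>\<^bsub>T_group scale\<^esub>"
    if "\<phi> \<in> carrier (T_group scale)" for \<phi>
  proof (rule bexI)
    have \<phi>: "word_char (?w \<phi>)"
      using that by (simp add: T_group_def word_char_of_character)
    then show "ext (word_inv (?w \<phi>)) \<in> carrier (T_group scale)"
      by (simp add: T_group_def ext_mem_qs_characters word_char_inv)
    have "word_inv (?w \<phi>) \<star> ?w \<phi> = word_unit"
      using \<phi> by (intro HOL.ext word_conv_inv) (simp add: word_char_def)
    then show "ext (word_inv (?w \<phi>)) \<otimes>\<^bsub>T_group scale\<^esub> \<phi> = \<one>\<^bsub>T_group scale\<^esub>"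
      by (simp add: T_group_def convolution_eq T_group_one)
  qed
qed

end

section \<open>The quotient algebra\<close>

lemma quot_class_eq_iff: "quot_class x = quot_class y \<longleftrightarrow> x - y \<in> nonsing_ideal"
  by (rule qsh_quot.abs_eq_iff)

lemma quot_class_rep [simp]: "quot_class (quot_rep c) = c"
  by (rule Quotient_abs_rep[OF Quotient_qsh_quot])

lemma quot_class_exhaust: obtains x where "c = quot_class x"
  by (metis quot_class_rep)

lemma quot_class_add: "quot_class (x + y) = quot_class x + quot_class y"
  and quot_class_mult: "quot_class (x \<^bold>* y) = quot_class x * quot_class y"
  and quot_class_scale: "quot_class (pm_scale c x) = quot_scale c (quot_class x)"
  and quot_class_zero: "quot_class 0 = 0"
  and quot_class_one: "quot_class (word []) = 1"
  by (simp_all add: plus_qsh_quot.abs_eq times_qsh_quot.abs_eq quot_scale.abs_eq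
      zero_qsh_quot_def one_qsh_quot_def)

lemmas quot_class_simps =
  quot_class_add quot_class_mult quot_class_scale quot_class_zero quot_class_one

lemma quot_class_nonsingular:
  assumes "nonsingular w"
  shows "quot_class (word w) = 0"
proof -
  have "word w \<in> nonsing_ideal"
    using word_in_nonsing_span[OF assms] by (auto simp: nonsing_ideal_def)
  then show ?thesis
    by (simp add: quot_class_eq_iff flip: quot_class_zero)
qed

text \<open>The quotient itself is taken as coefficient algebra, so that exponential and logarithm
  apply to the projection onto it, the universal character.\<close>

interpretation quot: rat_algebra quot_scale
proof
  show "quot_scale c x * y = quot_scale c (x * y)" for c x y
    by transfer (simp add: qs_mult_scale_left nonsing_ideal_zero)
qed

abbreviation class_word :: "int list \<Rightarrow> qsh_quot" where
  "class_word w \<equiv> quot_class (word w)"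

lemma quot_class_eq_ext: "quot_class x = quot.ext class_word x"
  by (induction x rule: qsh_induct) (simp_all add: quot_class_simps quot.ext_add quot.ext_scale)

lemma word_char_class_word: "quot.word_char class_word"
  unfolding quot.word_char_def
  by (auto simp: quot_class_simps quot_class_nonsingular
      simp flip: quot_class_eq_ext qs_mult_word)

abbreviation class_log :: "int list \<Rightarrow> qsh_quot" where
  "class_log \<equiv> quot.word_log class_word"

lemma class_exp_log: "quot.word_exp class_log = class_word"
  by (rule quot.word_exp_log) (rule quot_class_one)

lemma word_inf_char_class_log: "quot.word_inf_char class_log"
  by (rule quot.word_inf_char_log) (rule word_char_class_word)

section \<open>Generation of the quotient by logarithms of words\<close>

lemma gen_subalgebra_zero: "0 \<in> gen_subalgebra S"
  using gen_subalgebra.scale[OF gen_subalgebra.one, of 0] by simp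

lemma gen_subalgebra_sum: "(\<And>i. i \<in> I \<Longrightarrow> f i \<in> gen_subalgebra S) \<Longrightarrow> sum f I \<in> gen_subalgebra S"
  by (induction I rule: infinite_finite_induct) (auto intro: gen_subalgebra_zero gen_subalgebra.add)

lemma gen_subalgebra_least:
  assumes "S \<subseteq> gen_subalgebra T"
  shows "gen_subalgebra S \<subseteq> gen_subalgebra T"
proof
  show "x \<in> gen_subalgebra T" if "x \<in> gen_subalgebra S" for x
    using that by induction (use assms in \<open>auto intro: gen_subalgebra.intros\<close>)
qed

lemma gen_subalgebra_ext:
  assumes "\<And>w. w \<in> Poly_Mapping.keys x \<Longrightarrow> f w \<in> gen_subalgebra S"
  shows "quot.ext f x \<in> gen_subalgebra S"
  unfolding lin_ext_def by (intro gen_subalgebra_sum gen_subalgebra.scale assms)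

lemma gen_subalgebra_word_exp:
  assumes "\<And>w. g w \<in> gen_subalgebra S"
  shows "quot.word_exp g w \<in> gen_subalgebra S"
proof -
  have "quot.divpow g n w \<in> gen_subalgebra S" for n w
  proof (induction n arbitrary: w)
    case 0
    show ?case
      by (simp add: word_unit_def gen_subalgebra.one gen_subalgebra_zero)
  next
    case (Suc n)
    then show ?case
      unfolding quot.divpow.simps word_conv_def
      by (intro gen_subalgebra.scale gen_subalgebra_sum gen_subalgebra.mult assms)
  qed
  then show ?thesis
    by (simp add: quot.word_exp_def gen_subalgebra_sum)
qed

text \<open>The image of the convolution logarithm of \<open>\<H> \<rightarrow> \<H>/\<N>\<close>, that is, of the first Eulerian
  idempotent of \<open>\<H>/\<N>\<close>.\<close>

definition log_space :: "qsh_quot set" where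
  "log_space = range (quot.ext class_log)"

lemma subspace_log_space: "quot.subspace log_space"
proof (rule quot.subspaceI)
  show "0 \<in> log_space"
    unfolding log_space_def using quot.ext_zero[of class_log] by (metis rangeI)
  show "x + y \<in> log_space" if "x \<in> log_space" "y \<in> log_space" for x y
    using that by (auto simp: log_space_def simp flip: quot.ext_add)
  show "quot_scale c x \<in> log_space" if "x \<in> log_space" for c x
    using that by (auto simp: log_space_def simp flip: quot.ext_scale)
qed

lemma class_log_mem: "class_log w \<in> log_space"
  unfolding log_space_def using quot.ext_word[of class_log w] by (metis rangeI)

text \<open>By \<open>class_exp_log\<close>, the class of a word is a polynomial in values of
  \<open>class_log\<close>.\<close>

lemma gen_subalgebra_log_space: "gen_subalgebra log_space = UNIV"
proof -
  have "class_word w \<in> gen_subalgebra log_space" for w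
    using gen_subalgebra_word_exp[of class_log log_space w]
    by (simp add: class_exp_log class_log_mem gen_subalgebra.gen)
  then have "quot_class x \<in> gen_subalgebra log_space" for x
    by (subst quot_class_eq_ext) (rule gen_subalgebra_ext)
  then show ?thesis
    by (metis UNIV_eq_I quot_class_rep)
qed

section \<open>Characters of the quotient and linear maps on \<open>log_space\<close>\<close>

context rat_algebra
begin

text \<open>The kernel of a character is an ideal containing the nonsingular words, and
  \<open>nonsing_ideal\<close> is the smallest such ideal.\<close>

lemma character_nonsing_ideal:
  assumes "\<phi> \<in> qs_characters scale" "x \<in> nonsing_ideal"
  shows "\<phi> x = 0"
proof -
  have "\<phi> 0 = 0"
    using qs_characters_linear(2)[OF assms(1), of 0 0] by simp
  then have "qs_ideal {x. \<phi> x = 0}" "nonsing_span \<subseteq> {x. \<phi> x = 0}"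
    using assms(1) by (auto simp: qs_ideal_def qs_characters_linear[OF assms(1)] qs_characters_def)
  then show ?thesis
    using assms(2) by (auto simp: nonsing_ideal_def)
qed

lemma induced_class:
  assumes "\<phi> \<in> qs_characters scale"
  shows "induced \<phi> (quot_class x) = \<phi> x"
proof -
  have "quot_rep (quot_class x) - x \<in> nonsing_ideal"
    by (simp flip: quot_class_eq_iff)
  then have "\<phi> (quot_rep (quot_class x) - x) = 0"
    by (rule character_nonsing_ideal[OF assms])
  then show ?thesis
    using qs_characters_linear(1)[OF assms, of "quot_rep (quot_class x) - x" x] by (simp add: induced_def)
qed

lemma induced_hom:
  assumes "\<phi> \<in> qs_characters scale"
  shows "induced \<phi> (x + y) = induced \<phi> x + induced \<phi> y"
    and "induced \<phi> (quot_scale c x) = scale c (induced \<phi> x)"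
    and "induced \<phi> 1 = 1"
    and "induced \<phi> (x * y) = induced \<phi> x * induced \<phi> y"
proof -
  obtain a b where [simp]: "x = quot_class a" "y = quot_class b"
    by (metis quot_class_exhaust)
  have "\<phi> (word []) = 1" "\<phi> (a \<^bold>* b) = \<phi> a * \<phi> b"
    using assms by (auto simp: qs_characters_def)
  then show "induced \<phi> (x + y) = induced \<phi> x + induced \<phi> y"
    "induced \<phi> (quot_scale c x) = scale c (induced \<phi> x)"
    "induced \<phi> 1 = 1" "induced \<phi> (x * y) = induced \<phi> x * induced \<phi> y"
    by (simp_all add: induced_class[OF assms] qs_characters_linear[OF assms] flip: quot_class_simps)
qed

lemma induced_zero: "\<phi> \<in> qs_characters scale \<Longrightarrow> induced \<phi> 0 = 0"
  using induced_hom(2)[of \<phi> 0 0] by simp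

lemma induced_sum:
  "\<phi> \<in> qs_characters scale \<Longrightarrow> induced \<phi> (sum f I) = (\<Sum>i\<in>I. induced \<phi> (f i))"
  by (induction I rule: infinite_finite_induct) (simp_all add: induced_hom induced_zero)

text \<open>Convolution uses only the algebra structure of the target, so algebra morphisms commute
  with it.\<close>

lemma induced_divpow:
  assumes "\<phi> \<in> qs_characters scale"
  shows "induced \<phi> (quot.divpow g n w) = divpow (\<lambda>w. induced \<phi> (g w)) n w"
  by (induction n arbitrary: w)
    (auto simp: word_unit_def induced_zero induced_hom induced_sum divpow.simps quot.divpow.simps
      word_conv_def assms simp del: of_nat_Suc)

text \<open>Naturality of the logarithm, in exponential form: composing the logarithm of the
  projection with \<open>induced \<phi>\<close> gives a logarithm of \<open>\<phi>\<close>.\<close>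

lemma word_exp_induced_log:
  assumes "\<phi> \<in> qs_characters scale"
  shows "word_exp (\<lambda>w. induced \<phi> (class_log w)) = (\<lambda>w. \<phi> (word w))"
proof
  fix w
  have "word_exp (\<lambda>w. induced \<phi> (class_log w)) w = induced \<phi> (quot.word_exp class_log w)"
    by (simp add: word_exp_def quot.word_exp_def induced_sum induced_divpow assms)
  then show "word_exp (\<lambda>w. induced \<phi> (class_log w)) w = \<phi> (word w)"
    by (simp add: class_exp_log induced_class assms)
qed

lemma linear_map_log_space:
  assumes "f \<in> linear_maps_on scale log_space"
  shows "f (quot.ext class_log x) = ext (\<lambda>w. f (class_log w)) x"
  using assms
  by (induction x rule: qsh_induct)
    (simp_all add: linear_maps_on_def ext_add ext_scale quot.ext_add quot.ext_scale log_space_def)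

text \<open>\<open>class_log\<close> is an infinitesimal character with values in the quotient, and
  a linear map carries its zeros to zeros.\<close>

lemma word_inf_char_linear_map:
  assumes "f \<in> linear_maps_on scale log_space"
  shows "word_inf_char (\<lambda>w. f (class_log w))"
proof -
  have "f 0 = 0"
    using linear_map_log_space[OF assms, of 0] by simp
  then show ?thesis
    using word_inf_char_class_log
    by (simp add: word_inf_char_def quot.word_inf_char_def flip: linear_map_log_space[OF assms])
qed

lemma bij_betw_characters_linear_maps:
  "bij_betw (\<lambda>\<phi>. restrict (induced \<phi>) log_space) (qs_characters scale)
     (linear_maps_on scale log_space)"
proof (rule bij_betw_imageI)
  show "inj_on (\<lambda>\<phi>. restrict (induced \<phi>) log_space) (qs_characters scale)"
  proof (rule inj_onI)
    fix \<phi> \<psi>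
    assume *: "\<phi> \<in> qs_characters scale" "\<psi> \<in> qs_characters scale"
      and eq: "restrict (induced \<phi>) log_space = restrict (induced \<psi>) log_space"
    have "induced \<phi> (class_log w) = induced \<psi> (class_log w)" for w
      using fun_cong[OF eq, of "class_log w"] by (simp add: class_log_mem)
    then have "(\<lambda>w. \<phi> (word w)) = (\<lambda>w. \<psi> (word w))"
      by (simp flip: word_exp_induced_log[OF *(1)] word_exp_induced_log[OF *(2)])
    then show "\<phi> = \<psi>"
      using * by (metis qs_characters_ext)
  qed
  show "(\<lambda>\<phi>. restrict (induced \<phi>) log_space) ` qs_characters scale = linear_maps_on scale log_space"
  proof (intro equalityI subsetI)
    fix f assume "f \<in> (\<lambda>\<phi>. restrict (induced \<phi>) log_space) ` qs_characters scale"
    then show "f \<in> linear_maps_on scale log_space"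
      using quot.subspace_add[OF subspace_log_space] quot.subspace_scale[OF subspace_log_space]
      by (auto simp: linear_maps_on_def induced_hom)
  next
    fix f assume f: "f \<in> linear_maps_on scale log_space"
    let ?g = "\<lambda>w. f (class_log w)"
    let ?\<phi> = "ext (word_exp ?g)"
    have g: "word_inf_char ?g"
      by (rule word_inf_char_linear_map[OF f])
    then have \<phi>: "?\<phi> \<in> qs_characters scale"
      by (intro ext_mem_qs_characters word_char_exp)
    \<comment> \<open>Both functions vanish at the empty word and have the same exponential. Thus
      the new character restricts to \<open>f\<close> on the logarithms of words, which span
      \<open>log_space\<close>.\<close>
    have "(\<lambda>w. induced ?\<phi> (class_log w)) = ?g"
    proof (rule word_exp_inj)
      show "word_exp (\<lambda>w. induced ?\<phi> (class_log w)) = word_exp ?g"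
        by (simp add: word_exp_induced_log[OF \<phi>])
    qed (use g in \<open>simp_all add: word_inf_char_def induced_zero[OF \<phi>]\<close>)
    then have *: "induced ?\<phi> (class_log w) = ?g w" for w
      by metis
    have "induced ?\<phi> (quot.ext class_log x) = f (quot.ext class_log x)" for x
      unfolding linear_map_log_space[OF f]
      by (induction x rule: qsh_induct)
        (simp_all add: quot.ext_add quot.ext_scale ext_add ext_scale induced_hom[OF \<phi>] *)
    then have "restrict (induced ?\<phi>) log_space = f"
      using f by (intro extensionalityI[of _ log_space]) (auto simp: linear_maps_on_def log_space_def)
    with \<phi> show "f \<in> (\<lambda>\<phi>. restrict (induced \<phi>) log_space) ` qs_characters scale"
      by (intro image_eqI[where x = ?\<phi>]) simp_all
  qed
qed

end

section \<open>The unipotent representation attached to a word\<close>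

text \<open>The matrix coefficients of the comodule spanned by the prefixes of \<open>w\<close> are the factors
  of \<open>w\<close>.\<close>

definition word_mat :: "int list \<Rightarrow> qsh mat" where
  "word_mat w = mat (Suc (length w)) (Suc (length w))
     (\<lambda>(i, j). if i \<le> j then word (take (j - i) (drop i w)) else 0)"

lemma dim_word_mat [simp]:
  "dim_row (word_mat w) = Suc (length w)" "dim_col (word_mat w) = Suc (length w)"
  by (simp_all add: word_mat_def)

lemma word_mat_index:
  "i \<le> length w \<Longrightarrow> j \<le> length w
    \<Longrightarrow> word_mat w $$ (i, j) = (if i \<le> j then word (take (j - i) (drop i w)) else 0)"
  by (simp add: word_mat_def)

lemma word_mat_factor: "word_mat (p @ u @ q) $$ (length p, length p + length u) = word u"
  by (simp add: word_mat_index)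

lemma word_mat_factor_cases:
  assumes "i \<le> length w" "j \<le> length w"
  obtains "word_mat w $$ (i, j) = 0"
  | p u q where "w = p @ u @ q" "length p = i" "length p + length u = j"
      "word_mat w $$ (i, j) = word u"
proof (cases "i \<le> j")
  case True
  have "w = take i w @ take (j - i) (drop i w) @ drop (j - i) (drop i w)"
    by (simp only: append_take_drop_id)
  with that(2)[of "take i w" "take (j - i) (drop i w)" "drop (j - i) (drop i w)"] show thesis
    using True assms by (auto simp: word_mat_index)
qed (use that(1) assms in \<open>simp add: word_mat_index\<close>)

text \<open>One computation for two uses: \<open>G\<close> is the tensor product when coproducts are
  compared, and the product of character values when matrices are multiplied. Entries below the
  diagonal vanish, so the index runs over the cuts of the factor between \<open>i\<close> and
  \<open>j\<close>.\<close>

lemma sum_word_mat: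
  fixes G :: "qsh \<Rightarrow> qsh \<Rightarrow> 'b::comm_monoid_add"
  assumes ij: "i \<le> length w" "j \<le> length w" and G: "\<And>x. G 0 x = 0" "\<And>x. G x 0 = 0"
  shows "(\<Sum>k<Suc (length w). G (word_mat w $$ (i, k)) (word_mat w $$ (k, j)))
    = (if i \<le> j then \<Sum>k\<le>j - i. G (word (take k (take (j - i) (drop i w))))
        (word (drop k (take (j - i) (drop i w)))) else 0)"
proof (cases "i \<le> j")
  case True
  have "(\<Sum>k<Suc (length w). G (word_mat w $$ (i, k)) (word_mat w $$ (k, j)))
      = (\<Sum>k\<in>{i..j}. G (word_mat w $$ (i, k)) (word_mat w $$ (k, j)))"
    by (rule sum.mono_neutral_right) (use ij in \<open>auto simp: word_mat_index G\<close>)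
  also have "\<dots> = (\<Sum>k\<le>j - i. G (word (take k (take (j - i) (drop i w))))
        (word (drop k (take (j - i) (drop i w)))))"
    by (rule sum.reindex_bij_witness[where i = "\<lambda>k. k + i" and j = "\<lambda>k. k - i"])
      (use ij True in \<open>auto simp: word_mat_index drop_take min_def\<close>)
  finally show ?thesis using True by simp
next
  case False
  have "G (word_mat w $$ (i, k)) (word_mat w $$ (k, j)) = 0" if "k < Suc (length w)" for k
    using False ij that by (cases "i \<le> k") (auto simp: word_mat_index G)
  then show ?thesis using False by simp
qed

lemma unipotent_rep_word_mat: "unipotent_rep (word_mat w)"
  unfolding unipotent_rep_def
proof (intro conjI allI impI)
  show "map_mat quot_class (word_mat w) \<in> carrier (unitri_group (dim_row (word_mat w)))"
    by (auto simp: unitri_group_def upper_triangular_def word_mat_index quot_class_simps)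
next
  fix i j assume "i < dim_row (word_mat w)" "j < dim_row (word_mat w)"
  then have ij: "i \<le> length w" "j \<le> length w" by auto
  \<comment> \<open>The comodule identity holds in the tensor square before passing to the quotient,
    so the difference is zero.\<close>
  have "comul (word_mat w $$ (i, j)) = (\<Sum>k<Suc (length w). word_mat w $$ (i, k) \<otimes>\<^sub>H word_mat w $$ (k, j))"
    unfolding sum_word_mat[where G = tensor, OF ij tensor_zero]
  proof (cases "i \<le> j")
    case True
    have "length (take (j - i) (drop i w)) = j - i"
      using ij by simp
    then show "comul (word_mat w $$ (i, j)) = (if i \<le> j
        then \<Sum>k\<le>j - i. word (take k (take (j - i) (drop i w)))
          \<otimes>\<^sub>H word (drop k (take (j - i) (drop i w))) else 0)"
      by (simp only: word_mat_index[OF ij] True if_True comul_word)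
  qed (use ij in \<open>simp add: word_mat_index comul_def lin_ext_def\<close>)
  then show "comul (word_mat w $$ (i, j))
      - (\<Sum>k<dim_row (word_mat w). word_mat w $$ (i, k) \<otimes>\<^sub>H word_mat w $$ (k, j)) \<in> tensor_kernel"
    by (simp add: tensor_kernel_def pm.span_zero)
qed

lemma coord_ring_entry:
  "i < dim_row X \<Longrightarrow> j < dim_col X \<Longrightarrow> quot_class (X $$ (i, j)) \<in> coord_ring X"
  unfolding coord_ring_def by (intro gen_subalgebra.gen imageI elements_matI) auto

lemma class_factor_mem_coord_ring: "class_word u \<in> coord_ring (word_mat (p @ u @ q))"
  using coord_ring_entry[of "length p" "word_mat (p @ u @ q)" "length p + length u"]
  by (simp add: word_mat_factor)

text \<open>A factor of \<open>u\<close> is a factor of every word containing \<open>u\<close>. This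
  gives both the transition maps and the directedness of the system.\<close>

lemma coord_ring_factor: "coord_ring (word_mat u) \<subseteq> coord_ring (word_mat (p @ u @ q))"
  unfolding coord_ring_def[of "word_mat u"] coord_ring_def[of "word_mat (p @ u @ q)"]
proof (rule gen_subalgebra_least, clarify)
  fix x assume "x \<in> elements_mat (word_mat u)"
  then obtain i j where ij: "i \<le> length u" "j \<le> length u" "x = word_mat u $$ (i, j)"
    by (auto dest!: elements_matD simp: less_Suc_eq_le)
  from ij(1,2) have "quot_class (word_mat u $$ (i, j)) \<in> coord_ring (word_mat (p @ u @ q))"
  proof (cases rule: word_mat_factor_cases)
    case 1
    then show ?thesis by (simp add: quot_class_simps coord_ring_def gen_subalgebra_zero)
  next
    case (2 p' v q')
    then show ?thesis using class_factor_mem_coord_ring[of v "p @ p'" "q' @ q"] by simp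
  qed
  then show "quot_class x \<in> gen_subalgebra (quot_class ` elements_mat (word_mat (p @ u @ q)))"
    by (simp add: ij(3) coord_ring_def)
qed

lemma coord_ring_zero: "0 \<in> coord_ring X"
  and coord_ring_one: "1 \<in> coord_ring X"
  and coord_ring_add: "x \<in> coord_ring X \<Longrightarrow> y \<in> coord_ring X \<Longrightarrow> x + y \<in> coord_ring X"
  and coord_ring_mult: "x \<in> coord_ring X \<Longrightarrow> y \<in> coord_ring X \<Longrightarrow> x * y \<in> coord_ring X"
  and coord_ring_scale: "x \<in> coord_ring X \<Longrightarrow> quot_scale c x \<in> coord_ring X"
  by (auto simp: coord_ring_def gen_subalgebra_zero intro: gen_subalgebra.intros)

lemma ex_coord_ring: "\<exists>w. quot_class x \<in> coord_ring (word_mat w)"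
proof (induction x rule: qsh_induct)
  case (word w)
  show ?case using class_factor_mem_coord_ring[of w "[]" "[]"] by auto
next
  case (scale c x)
  then show ?case by (auto simp: quot_class_simps intro: coord_ring_scale)
next
  case (add x y)
  then obtain u v where "quot_class x \<in> coord_ring (word_mat u)" "quot_class y \<in> coord_ring (word_mat v)"
    by blast
  then have "quot_class (x + y) \<in> coord_ring (word_mat (u @ v))"
    using coord_ring_factor[of u "[]" v] coord_ring_factor[of v u "[]"]
    by (auto simp: quot_class_simps intro!: coord_ring_add)
  then show ?case by blast
qed

section \<open>Algebra maps on coordinate rings and points of the image groups\<close>

context rat_algebra
begin

lemma algebra_maps_onD:
  assumes "\<chi> \<in> algebra_maps_on scale (coord_ring X)"
  shows "\<chi> 0 = 0" "\<chi> 1 = 1"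
    and "x \<in> coord_ring X \<Longrightarrow> \<chi> (quot_scale c x) = scale c (\<chi> x)"
    and "x \<in> coord_ring X \<Longrightarrow> y \<in> coord_ring X \<Longrightarrow> \<chi> (x + y) = \<chi> x + \<chi> y"
    and "x \<in> coord_ring X \<Longrightarrow> y \<in> coord_ring X \<Longrightarrow> \<chi> (x * y) = \<chi> x * \<chi> y"
proof -
  show *: "\<chi> (quot_scale c x) = scale c (\<chi> x)" if "x \<in> coord_ring X" for c x
    using assms that by (simp add: algebra_maps_on_def linear_maps_on_def)
  show "\<chi> 0 = 0"
    using *[of 0 0] by (simp add: coord_ring_zero)
qed (use assms in \<open>simp_all add: algebra_maps_on_def linear_maps_on_def\<close>)

lemma algebra_map_ext:
  assumes \<chi>: "\<chi> \<in> algebra_maps_on scale (coord_ring X)"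
    and x: "\<And>w. w \<in> Poly_Mapping.keys x \<Longrightarrow> class_word w \<in> coord_ring X"
  shows "\<chi> (quot_class x) = ext (\<lambda>w. \<chi> (class_word w)) x"
proof -
  let ?f = "\<lambda>w. quot_scale (Poly_Mapping.lookup x w) (class_word w)"
  \<comment> \<open>\<open>\<chi>\<close> is known to be additive only inside the coordinate ring,
    so membership of the partial sums is carried through the induction.\<close>
  have "sum ?f K \<in> coord_ring X
      \<and> \<chi> (sum ?f K) = (\<Sum>w\<in>K. scale (Poly_Mapping.lookup x w) (\<chi> (class_word w)))"
    if "finite K" "K \<subseteq> Poly_Mapping.keys x" for K
    using that
    by (induction K)
      (simp_all add: algebra_maps_onD[OF \<chi>] coord_ring_zero coord_ring_add coord_ring_scale x)
  from this[of "Poly_Mapping.keys x"] show ?thesis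
    by (subst quot_class_eq_ext) (simp add: lin_ext_def)
qed

lemma restrict_induced:
  assumes "\<phi> \<in> qs_characters scale"
  shows "restrict (induced \<phi>) (coord_ring X) \<in> algebra_maps_on scale (coord_ring X)"
  by (auto simp: algebra_maps_on_def linear_maps_on_def induced_hom[OF assms]
      coord_ring_add coord_ring_mult coord_ring_scale coord_ring_one)

lemma point_restrict_induced:
  assumes "\<phi> \<in> qs_characters scale" "coord_ring X \<subseteq> coord_ring Y"
  shows "point X (restrict (induced \<phi>) (coord_ring Y)) = map_mat \<phi> X"
proof (rule eq_matI)
  fix i j assume "i < dim_row (map_mat \<phi> X)" "j < dim_col (map_mat \<phi> X)"
  then have "i < dim_row X" "j < dim_col X" by auto
  with coord_ring_entry[OF this] assms(2)
  show "point X (restrict (induced \<phi>) (coord_ring Y)) $$ (i, j) = map_mat \<phi> X $$ (i, j)"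
    by (auto simp: point_def induced_class[OF assms(1)])
qed (simp_all add: point_def)

lemma map_mat_convolution:
  assumes "\<phi> \<in> qs_characters scale" "\<psi> \<in> qs_characters scale"
  shows "map_mat (convolution scale \<phi> \<psi>) (word_mat w)
    = map_mat \<phi> (word_mat w) * map_mat \<psi> (word_mat w)"
proof (rule eq_matI)
  have zero: "\<phi> 0 = 0" "\<psi> 0 = 0"
    using qs_characters_linear(2)[OF assms(1), of 0 0] qs_characters_linear(2)[OF assms(2), of 0 0] by simp_all
  fix i j assume "i < dim_row (map_mat \<phi> (word_mat w) * map_mat \<psi> (word_mat w))"
    "j < dim_col (map_mat \<phi> (word_mat w) * map_mat \<psi> (word_mat w))"
  then have ij: "i \<le> length w" "j \<le> length w" by auto
  have "(map_mat \<phi> (word_mat w) * map_mat \<psi> (word_mat w)) $$ (i, j)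
      = (\<Sum>k<Suc (length w). \<phi> (word_mat w $$ (i, k)) * \<psi> (word_mat w $$ (k, j)))"
    using ij by (auto simp: scalar_prod_def atLeast0LessThan intro!: sum.cong)
  also have "\<dots> = convolution scale \<phi> \<psi> (word_mat w $$ (i, j))"
    using ij by (subst sum_word_mat) (auto simp: zero word_mat_index convolution_eq word_conv_def)
  finally show "map_mat (convolution scale \<phi> \<psi>) (word_mat w) $$ (i, j)
      = (map_mat \<phi> (word_mat w) * map_mat \<psi> (word_mat w)) $$ (i, j)"
    using ij by simp
qed simp_all

section \<open>Pro-unipotence\<close>

abbreviation restrict_rep :: "(qsh \<Rightarrow> 'a) \<Rightarrow> qsh mat \<Rightarrow> 'a mat" where
  "restrict_rep \<phi> \<equiv> \<lambda>X\<in>range word_mat. map_mat \<phi> X"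

lemma carrier_proj_limit:
  "carrier (proj_limit scale R) = {s \<in> \<Pi>\<^sub>E X\<in>R. point X ` algebra_maps_on scale (coord_ring X).
     \<forall>X\<in>R. \<forall>Y\<in>R. coord_ring X \<subseteq> coord_ring Y \<longrightarrow>
       (\<exists>\<chi>\<in>algebra_maps_on scale (coord_ring Y). s X = point X \<chi> \<and> s Y = point Y \<chi>)}"
  by (simp add: proj_limit_def image_group_def)

lemma restrict_rep_mem:
  assumes "\<phi> \<in> qs_characters scale"
  shows "restrict_rep \<phi> \<in> carrier (proj_limit scale (range word_mat))"
  unfolding carrier_proj_limit
proof (intro CollectI conjI ballI impI)
  show "restrict_rep \<phi> \<in> (\<Pi>\<^sub>E X\<in>range word_mat. point X ` algebra_maps_on scale (coord_ring X))"
    using restrict_induced[OF assms] by (intro restrict_PiE_iff[THEN iffD2] ballI)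
      (metis image_eqI order_refl point_restrict_induced[OF assms])
next
  fix X Y assume "X \<in> range word_mat" "Y \<in> range word_mat" "coord_ring X \<subseteq> coord_ring Y"
  then show "\<exists>\<chi>\<in>algebra_maps_on scale (coord_ring Y).
      restrict_rep \<phi> X = point X \<chi> \<and> restrict_rep \<phi> Y = point Y \<chi>"
    by (intro bexI[OF _ restrict_induced[OF assms]]) (simp add: point_restrict_induced[OF assms])
qed

text \<open>\<open>f\<close> reads its value at a word from the upper right corner of the matrix.
  Compatibility along the inclusion for a factor \<open>u\<close> of \<open>w\<close> shows that
  every occurrence of \<open>u\<close> in \<open>w\<close> gives this value, so one
  \<open>\<chi>\<close> computes \<open>f\<close> on all factors of \<open>w\<close> at
  once.\<close>

lemma proj_limit_factor:
  assumes s: "s \<in> carrier (proj_limit scale (range word_mat))"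
  defines "f \<equiv> \<lambda>w. s (word_mat w) $$ (0, length w)"
  obtains \<chi> where "\<chi> \<in> algebra_maps_on scale (coord_ring (word_mat w))"
    "s (word_mat w) = point (word_mat w) \<chi>"
    "\<And>p u q. w = p @ u @ q \<Longrightarrow> f u = \<chi> (class_word u)"
proof -
  have compat: "\<exists>\<chi>\<in>algebra_maps_on scale (coord_ring (word_mat w)).
      s (word_mat u) = point (word_mat u) \<chi> \<and> s (word_mat w) = point (word_mat w) \<chi>"
    if "w = p @ u @ q" for p u q
    using s coord_ring_factor[of u p q] that unfolding carrier_proj_limit by blast
  from compat[of "[]" w "[]"] obtain \<chi>
    where \<chi>: "\<chi> \<in> algebra_maps_on scale (coord_ring (word_mat w))" "s (word_mat w) = point (word_mat w) \<chi>"
    by auto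
  have "f u = \<chi> (class_word u)" if w: "w = p @ u @ q" for p u q
  proof -
    \<comment> \<open>\<open>\<chi>'\<close> depends on the factor and may differ from
      \<open>\<chi>\<close>, but both yield the matrix at \<open>w\<close>, hence agree on the entry
      that holds \<open>u\<close>.\<close>
    obtain \<chi>' where \<chi>': "s (word_mat u) = point (word_mat u) \<chi>'" "s (word_mat w) = point (word_mat w) \<chi>'"
      using compat[OF w] by blast
    have "f u = \<chi>' (class_word u)"
      by (simp add: f_def \<chi>' point_def word_mat_index)
    also have "\<dots> = s (word_mat w) $$ (length p, length p + length u)"
      unfolding \<chi>'(2) by (simp add: point_def w word_mat_factor)
    also have "\<dots> = \<chi> (class_word u)"
      unfolding \<chi>(2) by (simp add: point_def w word_mat_factor)
    finally show ?thesis .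
  qed
  with \<chi> show thesis by (rule that)
qed

lemma word_char_proj_limit:
  assumes s: "s \<in> carrier (proj_limit scale (range word_mat))"
  shows "word_char (\<lambda>w. s (word_mat w) $$ (0, length w))"
  unfolding word_char_def
proof (intro conjI allI impI)
  let ?f = "\<lambda>w. s (word_mat w) $$ (0, length w)"
  obtain \<chi> where \<chi>: "\<chi> \<in> algebra_maps_on scale (coord_ring (word_mat []))"
    and f: "\<And>p u q. [] = p @ u @ q \<Longrightarrow> ?f u = \<chi> (class_word u)"
    by (rule proj_limit_factor[OF s, of "[]"]) blast
  show "?f [] = 1"
    using f[of "[]" "[]" "[]"] algebra_maps_onD(2)[OF \<chi>] by (simp add: quot_class_simps)
next
  let ?f = "\<lambda>w. s (word_mat w) $$ (0, length w)"
  fix u v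
  obtain ks where ks: "set ks = Poly_Mapping.keys (qs_words u v)"
    using finite_list[OF finite_keys[of "qs_words u v"]] by (elim exE)
  \<comment> \<open>This word contains \<open>u\<close>, \<open>v\<close> and every word of their
    product as factors, so a single algebra map evaluates them all and turns the product relation in
    the quotient into the claim.\<close>
  let ?w = "u @ v @ concat ks"
  obtain \<chi> where \<chi>: "\<chi> \<in> algebra_maps_on scale (coord_ring (word_mat ?w))"
    and "s (word_mat ?w) = point (word_mat ?w) \<chi>"
    and f: "\<And>p u' q. ?w = p @ u' @ q \<Longrightarrow> ?f u' = \<chi> (class_word u')"
    by (rule proj_limit_factor[OF s, of ?w], rule that, assumption+)
  have k: "?f k = \<chi> (class_word k)" "class_word k \<in> coord_ring (word_mat ?w)"
    if "k \<in> Poly_Mapping.keys (qs_words u v)" for k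
  proof -
    from that have "k \<in> set ks" by (simp add: ks)
    then obtain xs ys where "ks = xs @ k # ys" by (metis split_list)
    then have w: "?w = (u @ v @ concat xs) @ k @ concat ys" by simp
    show "?f k = \<chi> (class_word k)"
      by (rule f[OF w])
    show "class_word k \<in> coord_ring (word_mat ?w)"
      unfolding w by (rule class_factor_mem_coord_ring)
  qed
  have "ext ?f (qs_words u v) = ext (\<lambda>w. \<chi> (class_word w)) (qs_words u v)"
    by (rule ext_cong) (rule k)
  also have "\<dots> = \<chi> (quot_class (qs_words u v))"
    by (rule algebra_map_ext[OF \<chi>, symmetric]) (rule k)
  also have "\<dots> = \<chi> (class_word u * class_word v)"
    by (simp flip: qs_mult_word quot_class_mult)
  also have "\<dots> = \<chi> (class_word u) * \<chi> (class_word v)"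
    using class_factor_mem_coord_ring[of u "[]" "v @ concat ks"]
      class_factor_mem_coord_ring[of v u "concat ks"]
    by (intro algebra_maps_onD(5)[OF \<chi>]) auto
  also have "\<dots> = ?f u * ?f v"
    using f[of "[]" u "v @ concat ks"] f[of u v "concat ks"] by simp
  finally show "ext ?f (qs_words u v) = ?f u * ?f v" .
next
  let ?f = "\<lambda>w. s (word_mat w) $$ (0, length w)"
  fix w :: "int list" assume w: "nonsingular w"
  obtain \<chi> where \<chi>: "\<chi> \<in> algebra_maps_on scale (coord_ring (word_mat w))"
    and f: "\<And>p u q. w = p @ u @ q \<Longrightarrow> ?f u = \<chi> (class_word u)"
    by (rule proj_limit_factor[OF s, of w]) blast
  show "?f w = 0"
    using f[of "[]" w "[]"] algebra_maps_onD(1)[OF \<chi>] by (simp add: quot_class_nonsingular[OF w])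
qed

lemma restrict_rep_iso: "restrict_rep \<in> iso (T_group scale) (proj_limit scale (range word_mat))"
  unfolding iso_def
proof (intro CollectI conjI bij_betw_imageI)
  show "restrict_rep \<in> hom (T_group scale) (proj_limit scale (range word_mat))"
  proof (rule homI)
    fix \<phi> \<psi> assume "\<phi> \<in> carrier (T_group scale)" "\<psi> \<in> carrier (T_group scale)"
    then show "restrict_rep (\<phi> \<otimes>\<^bsub>T_group scale\<^esub> \<psi>)
        = restrict_rep \<phi> \<otimes>\<^bsub>proj_limit scale (range word_mat)\<^esub> restrict_rep \<psi>"
      by (simp add: T_group_def proj_limit_def image_group_def unitri_group_def)
        (rule restrict_ext, auto simp: map_mat_convolution)
  qed (simp only: T_group_def partial_object.simps restrict_rep_mem)
  show "inj_on restrict_rep (carrier (T_group scale))"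
  proof (rule inj_onI)
    fix \<phi> \<psi> assume *: "\<phi> \<in> carrier (T_group scale)" "\<psi> \<in> carrier (T_group scale)"
      and eq: "restrict_rep \<phi> = restrict_rep \<psi>"
    have "\<phi> (word w) = \<psi> (word w)" for w
    proof -
      have "map_mat \<phi> (word_mat w) $$ (0, length w) = map_mat \<psi> (word_mat w) $$ (0, length w)"
        using fun_cong[OF eq, of "word_mat w"] by simp
      then show ?thesis by (simp add: word_mat_index)
    qed
    then have "(\<lambda>w. \<phi> (word w)) = (\<lambda>w. \<psi> (word w))"
      by (rule HOL.ext)
    moreover have "\<phi> \<in> qs_characters scale" "\<psi> \<in> qs_characters scale"
      using * by (simp_all add: T_group_def)
    ultimately show "\<phi> = \<psi>"
      by (metis qs_characters_ext)
  qed
  show "restrict_rep ` carrier (T_group scale) = carrier (proj_limit scale (range word_mat))"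
  proof (intro equalityI subsetI)
    fix s assume s: "s \<in> carrier (proj_limit scale (range word_mat))"
    let ?f = "\<lambda>w. s (word_mat w) $$ (0, length w)"
    \<comment> \<open>The preimage of \<open>s\<close> is read off from the corner entries; every
      other entry is zero or a factor of \<open>w\<close>, where \<open>?f\<close> agrees with
      \<open>\<chi>\<close>.\<close>
    have "map_mat (ext ?f) (word_mat w) = s (word_mat w)" for w
    proof -
      obtain \<chi> where \<chi>: "\<chi> \<in> algebra_maps_on scale (coord_ring (word_mat w))"
        and sw: "s (word_mat w) = point (word_mat w) \<chi>"
        and f: "\<And>p u q. w = p @ u @ q \<Longrightarrow> ?f u = \<chi> (class_word u)"
        by (rule proj_limit_factor[OF s, of w]) blast
      show ?thesis
        unfolding sw
      proof (rule eq_matI)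
        fix i j assume "i < dim_row (point (word_mat w) \<chi>)" "j < dim_col (point (word_mat w) \<chi>)"
        then have ij: "i \<le> length w" "j \<le> length w" by (auto simp: point_def)
        then show "map_mat (ext ?f) (word_mat w) $$ (i, j) = point (word_mat w) \<chi> $$ (i, j)"
        proof (cases rule: word_mat_factor_cases)
          case 1
          with ij show ?thesis
            by (simp add: point_def quot_class_simps algebra_maps_onD[OF \<chi>])
        next
          case (2 p u q)
          with ij show ?thesis
            using f[OF 2(1)] by (simp add: point_def)
        qed
      qed (simp_all add: point_def)
    qed
    moreover have "s \<in> extensional (range word_mat)"
      using s by (auto simp: carrier_proj_limit PiE_iff)
    ultimately have "restrict_rep (ext ?f) = s"
      by (intro extensionalityI[of _ "range word_mat"]) auto
    moreover have "ext ?f \<in> carrier (T_group scale)"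
      using word_char_proj_limit[OF s] by (simp add: T_group_def ext_mem_qs_characters)
    ultimately show "s \<in> restrict_rep ` carrier (T_group scale)"
      by (intro image_eqI[where x = "ext ?f"]) simp_all
  qed (auto simp: T_group_def restrict_rep_mem)
qed

lemma T_group_pro_unipotent: "T_pro_unipotent scale"
  unfolding T_pro_unipotent_def
proof (intro exI[where x = "range word_mat"] conjI ballI)
  fix X Y assume "X \<in> range word_mat" "Y \<in> range word_mat"
  then obtain u v where "X = word_mat u" "Y = word_mat v" by blast
  then show "\<exists>Z\<in>range word_mat. coord_ring X \<union> coord_ring Y \<subseteq> coord_ring Z"
    using coord_ring_factor[of u "[]" v] coord_ring_factor[of v u "[]"]
    by (intro bexI[where x = "word_mat (u @ v)"]) auto
next
  have "c \<in> (\<Union>X\<in>range word_mat. coord_ring X)" for c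
    using ex_coord_ring by (metis UN_iff quot_class_rep rangeI)
  then show "(\<Union>X\<in>range word_mat. coord_ring X) = UNIV"
    by blast
qed (use unipotent_rep_word_mat restrict_rep_iso in auto)

end

theorem theorem5p2:
  fixes scale :: "rat \<Rightarrow> 'a::{comm_ring, comm_monoid_mult} \<Rightarrow> 'a"
  assumes "rat_algebra scale"
  shows "group (T_group scale) \<and> T_pro_unipotent scale
    \<and> (\<exists>W. quot.subspace W \<and> gen_subalgebra W = UNIV
        \<and> bij_betw (\<lambda>\<phi>. restrict (induced \<phi>) W)
            (carrier (T_group scale)) (linear_maps_on scale W))"
proof -
  interpret rat_algebra scale by fact
  have "bij_betw (\<lambda>\<phi>. restrict (induced \<phi>) log_space)
      (carrier (T_group scale)) (linear_maps_on scale log_space)"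
    using bij_betw_characters_linear_maps by (simp add: T_group_def)
  then show ?thesis
    using group_T_group T_group_pro_unipotent subspace_log_space gen_subalgebra_log_space by blast
qed

end
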